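(* Let $f_1,f_2\in{\cal N}_1$. Then $f_1f_2\in{\cal N}_1$ if and only if the divisor $((a_n),(b_n))$ of $f_1f_2$ satisfies $\inf_{n,k}|a_n-b_k|>0$ and there is $R_0<\infty$ such that every disc $B(w,R_0)$, $w\in\mathbb{C}$, contains some $a_n$ and some $b_k$. The same statement holds with ${\cal N}_1$ replaced by ${\cal AE}$ throughout.
   Context: $\rho_S$ is the spherical metric. A meromorphic $f$ on $\mathbb{C}$ is normal if every sequence of translates $f(z+h_n)$ has a subsequence Cauchy in $\rho_S$ uniformly on compacta; $f\in{\cal N}_1$ if moreover no limit of translates is a constant (including $\infty$). A nonconstant meromorphic $f$ is in ${\cal AE}$ if for every $\varepsilon>0$ there is $L$ such that every disc of radius $L$ contains $\tau$ with $\rho_S(f(z+\tau),f(z))<\varepsilon$ for all $z\in\mathbb{C}$. The divisor of $f_1f_2$ lists its zeros $a_n$ and poles $b_n$ with multiplicities (after cancellation). *)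

theory Defs
  imports "HOL-Analysis.Analysis"
begin

text \<open>Meromorphic functions on the whole plane, represented by a complex-valued function
  whose values at the (isolated) exceptional points are irrelevant: there is a set P without
  accumulation points in the plane, f is holomorphic off P, and at each point of P f has
  either a pole or a removable singularity.\<close>
definition meromorphic_C :: "(complex \<Rightarrow> complex) \<Rightarrow> bool" where
  "meromorphic_C f \<longleftrightarrow> (\<exists>P. (\<forall>z. \<not> z islimpt P) \<and> f holomorphic_on (- P) \<and>
     (\<forall>p\<in>P. filterlim f at_infinity (at p) \<or> (\<exists>c. (f \<longlongrightarrow> c) (at p))))"

definition sval :: "(complex \<Rightarrow> complex) \<Rightarrow> complex \<Rightarrow> complex option" where
  "sval f z = (if filterlim f at_infinity (at z) then None else Some (Lim (at z) f))"

fun chord :: "complex option \<Rightarrow> complex option \<Rightarrow> real" where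
  "chord None None = 0"
| "chord (Some z) None = 2 / sqrt (1 + (cmod z)^2)"
| "chord None (Some w) = 2 / sqrt (1 + (cmod w)^2)"
| "chord (Some z) (Some w) = 2 * cmod (z - w) / sqrt ((1 + (cmod z)^2) * (1 + (cmod w)^2))"

definition normal_mero :: "(complex \<Rightarrow> complex) \<Rightarrow> bool" where
  "normal_mero f \<longleftrightarrow> (\<forall>h :: nat \<Rightarrow> complex. \<exists>r :: nat \<Rightarrow> nat. strict_mono r \<and>
     (\<forall>K. compact K \<longrightarrow> (\<forall>\<epsilon>>0. \<exists>N. \<forall>m\<ge>N. \<forall>n\<ge>N. \<forall>z\<in>K.
        chord (sval f (z + h (r m))) (sval f (z + h (r n))) < \<epsilon>)))"

definition translate_limit :: "(complex \<Rightarrow> complex) \<Rightarrow> (nat \<Rightarrow> complex) \<Rightarrow> (complex \<Rightarrow> complex option) \<Rightarrow> bool" where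
  "translate_limit f h F \<longleftrightarrow> (\<forall>K. compact K \<longrightarrow> (\<forall>\<epsilon>>0. \<exists>N. \<forall>n\<ge>N. \<forall>z\<in>K.
        chord (sval f (z + h n)) (F z) < \<epsilon>))"

definition class_N1 :: "(complex \<Rightarrow> complex) \<Rightarrow> bool" where
  "class_N1 f \<longleftrightarrow> meromorphic_C f \<and> normal_mero f \<and>
     \<not> (\<exists>h c. translate_limit f h (\<lambda>_. c))"

definition class_AE :: "(complex \<Rightarrow> complex) \<Rightarrow> bool" where
  "class_AE f \<longleftrightarrow> meromorphic_C f \<and> (\<exists>z w. sval f z \<noteq> sval f w) \<and>
     (\<forall>\<epsilon>>0. \<exists>L. \<forall>w. \<exists>\<tau>. cmod (\<tau> - w) < L \<and>
        (\<forall>z. chord (sval f (z + \<tau>)) (sval f z) < \<epsilon>))"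

text \<open>Zeros and poles (after cancellation) of a meromorphic function.\<close>
definition mzeros :: "(complex \<Rightarrow> complex) \<Rightarrow> complex set" where
  "mzeros f = {z. sval f z = Some 0}"

definition mpoles :: "(complex \<Rightarrow> complex) \<Rightarrow> complex set" where
  "mpoles f = {z. sval f z = None}"

end

theory Submission
  imports Defs "HOL-Complex_Analysis.Complex_Analysis"
begin

text \<open>
  Zeros of one factor may cancel poles of the other, so closeness of translates of the factors gives closeness of
  translates of the product \<open>f\<^sub>1 f\<^sub>2\<close> only away from these points.
  Limits of translates of \<open>f\<^sub>1\<close> and \<open>f\<^sub>2\<close> are nonconstant, so some small circle around any given point avoids
  all their zeros and poles; there the product of the factors converges uniformly to finite nonzero values.
  If zeros and poles of the product are separated, each small disc contains only zeros or only poles, and the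
  maximum principle, applied to the product or its reciprocal, carries closeness on the circle to the centre.
  Thus closeness of two translates of both factors implies closeness of the translates of the product, which yields
  normality of the product and, applied to common almost periods of the factors, its almost periodicity.
  Conversely, separation is spherical equicontinuity. If there were arbitrarily large pole-free discs, then
  translating their centres to the origin would produce a constant limit, by Liouville's theorem or (if the values
  are unbounded) by Hurwitz's theorem; zeros are treated by passing to the reciprocal.
\<close>

section \<open>The chordal metric\<close>

text \<open>Stereographic projection onto the unit sphere of \<open>\<complex> \<times> \<real>\<close>; it turns \<^const>\<open>chord\<close> into a distance.\<close>

fun emb :: "complex option \<Rightarrow> complex \<times> real" where
  "emb None = (0, 1)"
| "emb (Some z) = ((2 / (1 + (cmod z)\<^sup>2)) *\<^sub>R z, ((cmod z)\<^sup>2 - 1) / (1 + (cmod z)\<^sup>2))"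

lemma one_plus_square_pos: "1 + (cmod z)\<^sup>2 > 0"
  by (smt (verit) zero_le_power2)

lemma inner_complex_eq: "2 * (a \<bullet> b) = (cmod a)\<^sup>2 + (cmod b)\<^sup>2 - (cmod (a - b))\<^sup>2" for a b :: complex
  by (simp add: power2_norm_eq_inner algebra_simps inner_commute)

lemma norm_emb: "norm (emb x) = 1"
proof (cases x)
  case (Some z)
  define s where "s = (cmod z)\<^sup>2"
  have s: "1 + s > 0" using one_plus_square_pos s_def by simp
  have "(norm (emb x))\<^sup>2 = (2 / (1 + s))\<^sup>2 * s + ((s - 1) / (1 + s))\<^sup>2"
    using s by (simp add: Some norm_Pair power_divide power_mult_distrib s_def)
  also have "\<dots> = 1" using s by (simp add: divide_simps power2_eq_square) (simp add: algebra_simps)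
  finally show ?thesis by (simp add: power2_eq_1_iff) (smt (verit) norm_ge_zero)
qed (simp add: norm_Pair)

text \<open>For unit vectors, 2 minus twice the inner product is the squared Euclidean distance.
  Since \<open>emb\<close> has unit values, this identifies \<open>chord\<close> with the distance
  of stereographic images and makes it a metric.\<close>

lemma chord_eq_inner: "(chord x y)\<^sup>2 = 2 - 2 * (emb x \<bullet> emb y)"
proof (cases x; cases y)
  fix z w assume xy: "x = Some z" "y = Some w"
  define s t where "s = (cmod z)\<^sup>2" and "t = (cmod w)\<^sup>2"
  have s: "1 + s > 0" "1 + t > 0" using one_plus_square_pos s_def t_def by auto
  have i: "2 * (z \<bullet> w) = s + t - (cmod (z - w))\<^sup>2" unfolding s_def t_def by (rule inner_complex_eq)
  have "emb x \<bullet> emb y = (2 / (1+s)) * (2 / (1+t)) * (z \<bullet> w) + ((s-1)/(1+s)) * ((t-1)/(1+t))"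
    by (simp add: xy inner_Pair s_def t_def)
  then have 1: "2 - 2 * (emb x \<bullet> emb y) = 2 - (4 / ((1+s) * (1+t))) * (2 * (z \<bullet> w)) - 2 * ((s-1)*(t-1)) / ((1+s) * (1+t))"
    by simp
  have 2: "\<dots> = 4 * (cmod (z - w))\<^sup>2 / ((1+s) * (1+t))"
    unfolding i using s by (simp add: divide_simps) (simp add: algebra_simps)
  have "(chord x y)\<^sup>2 = 4 * (cmod (z - w))\<^sup>2 / ((1+s) * (1+t))"
    using s by (simp add: xy power_divide power_mult_distrib s_def t_def)
  then show ?thesis using 1 2 by simp
next
  fix z assume xy: "x = Some z" "y = None"
  show ?thesis using one_plus_square_pos[of z]
    by (simp add: xy inner_Pair power_divide divide_simps)
next
  fix z assume xy: "x = None" "y = Some z"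
  show ?thesis using one_plus_square_pos[of z]
    by (simp add: xy inner_Pair power_divide divide_simps)
qed (simp add: inner_Pair)

lemma chord_nonneg: "0 \<le> chord x y"
  by (cases x; cases y) auto

lemma chord_dist: "chord x y = dist (emb x) (emb y)"
proof -
  have "(dist (emb x) (emb y))\<^sup>2 = (norm (emb x))\<^sup>2 + (norm (emb y))\<^sup>2 - 2 * (emb x \<bullet> emb y)"
    unfolding dist_norm power2_norm_eq_inner by (simp add: algebra_simps inner_commute)
  then have "(dist (emb x) (emb y))\<^sup>2 = (chord x y)\<^sup>2"
    by (simp add: norm_emb chord_eq_inner)
  then show ?thesis using chord_nonneg by (simp add: power2_eq_iff_nonneg)
qed

lemma chord_commute: "chord x y = chord y x"
  by (simp add: chord_dist dist_commute)

lemma chord_triangle: "chord x z \<le> chord x y + chord y z"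
  by (simp add: chord_dist dist_triangle)

lemma chord_self [simp]: "chord x x = 0"
  by (simp add: chord_dist)

lemma chord_eq_0_iff: "chord x y = 0 \<longleftrightarrow> x = y"
proof
  assume "chord x y = 0" then show "x = y"
    using one_plus_square_pos by (cases x; cases y) (auto simp: add_eq_0_iff, (smt (verit) zero_le_power2)+)
qed simp

lemma emb_eq_iff: "emb x = emb y \<longleftrightarrow> x = y"
  using chord_eq_0_iff[of x y] by (simp add: chord_dist)

text \<open>Limits of spherical values are first found as points of the sphere; surjectivity turns
  them back into elements of \<open>complex option\<close>.\<close>

lemma range_emb: "range emb = sphere 0 1"
proof
  show "range emb \<subseteq> sphere 0 1" by (auto simp: norm_emb)
  show "sphere 0 1 \<subseteq> range emb"
  proof
    fix p :: "complex \<times> real" assume p: "p \<in> sphere 0 1"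
    obtain w t where wt: "p = (w, t)" by (cases p)
    have n: "(cmod w)\<^sup>2 + t\<^sup>2 = 1" using p by (simp add: wt norm_Pair)
    show "p \<in> range emb"
    proof (cases "t = 1")
      case True
      then have "w = 0" using n by simp
      then have "p = emb None" using True wt by simp
      then show ?thesis by blast
    next
      case False
      \<comment> \<open>Inverse stereographic projection from the pole \<open>(0, 1)\<close>, which
        is the image of \<open>None\<close>.\<close>
      define z where "z = (1 / (1 - t)) *\<^sub>R w"
      have t1: "1 - t \<noteq> 0" using False by simp
      have "(cmod z)\<^sup>2 = (1 / (1 - t))\<^sup>2 * (cmod w)\<^sup>2"
        by (simp add: z_def power_divide)
      also have "(cmod w)\<^sup>2 = (1 + t) * (1 - t)" using n by (simp add: algebra_simps power2_eq_square)
      finally have sq: "(cmod z)\<^sup>2 = (1 + t) / (1 - t)"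
        using t1 by (simp add: power2_eq_square)
      have "1 + (cmod z)\<^sup>2 = 2 / (1 - t)" using t1 by (simp add: sq divide_simps)
      moreover have "((cmod z)\<^sup>2 - 1) = 2 * t / (1 - t)" using t1 by (simp add: sq divide_simps)
      ultimately have "emb (Some z) = ((1 - t) *\<^sub>R z, t)" using t1 by simp
      also have "\<dots> = p" using t1 by (simp add: z_def wt)
      finally show ?thesis by (metis rangeI)
    qed
  qed
qed

section \<open>The reciprocal as an isometry of the sphere\<close>

fun oinv :: "complex option \<Rightarrow> complex option" where
  "oinv None = Some 0"
| "oinv (Some z) = (if z = 0 then None else Some (1 / z))"

lemma oinv_oinv [simp]: "oinv (oinv x) = x"
  by (cases x) auto

lemma oinv_eq_None_iff [simp]: "oinv x = None \<longleftrightarrow> x = Some 0"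
  by (cases x) auto

lemma oinv_eq_Some_0_iff [simp]: "oinv x = Some 0 \<longleftrightarrow> x = None"
  by (cases x) auto

text \<open>On the sphere the reciprocal is the half turn about the real axis. Hence it preserves
  \<open>chord\<close> and continuity, and statements about zeros transfer to poles.\<close>

lemma emb_oinv: "emb (oinv x) = (cnj (fst (emb x)), - snd (emb x))"
proof (cases x)
  case (Some z)
  show ?thesis
  proof (cases "z = 0")
    case False
    define s where "s = (cmod z)\<^sup>2"
    have s: "s > 0" "1 + s > 0" "complex_of_real s \<noteq> 0" using False by (auto simp: s_def add_pos_pos)
    have inv: "1 / z = cnj z / complex_of_real s"
      using False s complex_norm_square[of z] by (simp add: s_def field_simps)
    have c: "(cmod (1 / z))\<^sup>2 = 1 / s" by (simp add: s_def norm_divide power_divide)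
    have a: "2 / (1 + 1 / s) = 2 * s / (1 + s)" using s by (simp add: divide_simps)
    have "snd (emb (oinv x)) = (1 / s - 1) / (1 + 1 / s)" using False by (simp add: Some c del: norm_divide)
    also have "\<dots> = - ((s - 1) / (1 + s))" using s by (simp add: divide_simps)
    finally have 1: "snd (emb (oinv x)) = - snd (emb x)" by (simp add: Some s_def)
    have "fst (emb (oinv x)) = (2 / (1 + 1 / s)) *\<^sub>R (1 / z)"
      using False c by (simp only: Some oinv.simps if_False emb.simps fst_conv)
    also have "\<dots> = (2 / (1 + s)) *\<^sub>R cnj z"
      unfolding inv a using s by (simp add: scaleR_conv_of_real)
    finally have "fst (emb (oinv x)) = cnj (fst (emb x))" by (simp add: Some s_def)
    with 1 show ?thesis by (simp add: prod_eq_iff)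
  qed (simp add: Some)
qed simp

lemma chord_oinv [simp]: "chord (oinv x) (oinv y) = chord x y"
proof -
  have "dist (cnj a, - s) (cnj b, - t) = dist (a, s) (b, t)" for a b and s t :: real
    by (simp add: norm_Pair dist_Pair_Pair dist_norm power2_commute[of s t] flip: complex_cnj_diff)
  then show ?thesis by (metis chord_dist emb_oinv prod.collapse)
qed

section \<open>Chordal against Euclidean distance\<close>

lemma chord_Some_le: "chord (Some a) (Some b) \<le> 2 * cmod (a - b)"
proof -
  have "1 * 1 \<le> (1 + (cmod a)\<^sup>2) * (1 + (cmod b)\<^sup>2)" by (intro mult_mono) auto
  then have "sqrt ((1 + (cmod a)\<^sup>2) * (1 + (cmod b)\<^sup>2)) \<ge> 1" by simp
  then have "2 * cmod (a - b) / sqrt ((1 + (cmod a)\<^sup>2) * (1 + (cmod b)\<^sup>2)) \<le> 2 * cmod (a - b) / 1"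
    by (intro divide_left_mono) auto
  then show ?thesis by simp
qed

text \<open>A point of modulus at most \<open>M\<close> has chordal distance at least
  \<open>2 / sqrt (1 + M\<^sup>2)\<close> from infinity. If \<open>x\<close> is within half of that,
  it keeps the other half as distance from infinity, which bounds its modulus and so the denominator
  in \<open>chord\<close>.\<close>

lemma chord_close_finite:
  assumes a: "cmod a \<le> M" and x: "chord (Some a) x \<le> \<eta>" and \<eta>: "\<eta> \<le> 1 / sqrt (1 + M\<^sup>2)"
  obtains b where "x = Some b" "cmod (a - b) \<le> \<eta> * (1 + M\<^sup>2)"
proof -
  define A where "A = sqrt (1 + (cmod a)\<^sup>2)"
  define S where "S = sqrt (1 + M\<^sup>2)"
  have M0: "0 \<le> M" using a norm_ge_zero order_trans by blast
  have AS: "0 < A" "A \<le> S" "0 < S" "1 \<le> A"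
    using a M0 unfolding A_def S_def by (auto simp: add_pos_nonneg power_mono)
  have "chord (Some a) None = 2 / A" by (simp add: A_def)
  moreover have "2 / A \<ge> 2 / S" using AS by (simp add: frac_le)
  ultimately have "2 / S \<le> chord (Some a) x + chord x None" using chord_triangle[of "Some a" None x] by linarith
  then have xN: "1 / S \<le> chord x None" using x \<eta> S_def by (simp add: field_simps)
  then obtain b where b: "x = Some b" using AS by (cases x) auto
  define B where "B = sqrt (1 + (cmod b)\<^sup>2)"
  have B: "B > 0" unfolding B_def by (simp add: add_pos_nonneg)
  have "1 / S \<le> 2 / B" using xN by (simp add: b B_def)
  then have BS: "B \<le> 2 * S" using AS B by (simp add: field_simps)
  have "chord (Some a) x = 2 * cmod (a - b) / (A * B)" by (simp add: b A_def B_def real_sqrt_mult)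
  then have "2 * cmod (a - b) = chord (Some a) x * (A * B)" using AS B by simp
  also have "\<dots> \<le> \<eta> * (S * (2 * S))"
    using x AS B BS chord_nonneg[of "Some a" x] by (intro mult_mono) auto
  also have "S * (2 * S) = 2 * (1 + M\<^sup>2)" unfolding S_def by (simp add: algebra_simps)
  finally have "cmod (a - b) \<le> \<eta> * (1 + M\<^sup>2)" by (simp add: algebra_simps)
  with b that show ?thesis by blast
qed

lemma continuous_on_emb_Some [continuous_intros]:
  assumes "continuous_on S u"
  shows "continuous_on S (\<lambda>z. emb (Some (u z)))"
  unfolding emb.simps using one_plus_square_pos
  by (intro continuous_intros assms) (metis less_irrefl of_real_eq_0_iff)+

lemma continuous_on_emb_oinv:
  assumes "continuous_on S (\<lambda>z. emb (g z))"
  shows "continuous_on S (\<lambda>z. emb (oinv (g z)))"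
  unfolding emb_oinv by (intro continuous_intros assms)

section \<open>Meromorphic maps into the sphere\<close>

text \<open>Meromorphic maps into the sphere, phrased so that the notion is visibly invariant under \<^const>\<open>oinv\<close>;
  the constant map \<^const>\<open>None\<close> is included because it can arise as a limit.\<close>

definition smero :: "(complex \<Rightarrow> complex option) \<Rightarrow> bool" where
  "smero g \<longleftrightarrow> (\<forall>z0. \<exists>r>0. \<exists>u. u holomorphic_on ball z0 r \<and>
     ((\<forall>z\<in>ball z0 r. g z = Some (u z)) \<or> (\<forall>z\<in>ball z0 r. g z = oinv (Some (u z)))))"

lemma smeroE:
  assumes "smero g"
  obtains r u where "r > 0" "u holomorphic_on ball z0 r"
    "(\<forall>z\<in>ball z0 r. g z = Some (u z)) \<or> (\<forall>z\<in>ball z0 r. g z = oinv (Some (u z)))"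
  using assms unfolding smero_def by meson

lemma smero_oinv:
  assumes "smero g" shows "smero (\<lambda>z. oinv (g z))"
  unfolding smero_def
proof
  fix z0
  obtain r u where "r > 0" "u holomorphic_on ball z0 r"
    "(\<forall>z\<in>ball z0 r. g z = Some (u z)) \<or> (\<forall>z\<in>ball z0 r. g z = oinv (Some (u z)))"
    using assms by (rule smeroE)
  then show "\<exists>r>0. \<exists>u. u holomorphic_on ball z0 r \<and>
     ((\<forall>z\<in>ball z0 r. oinv (g z) = Some (u z)) \<or> (\<forall>z\<in>ball z0 r. oinv (g z) = oinv (Some (u z))))"
    by (metis oinv_oinv)
qed

lemma smero_translate:
  assumes "smero g" shows "smero (\<lambda>z. g (z + h))"
  unfolding smero_def
proof
  fix z0
  obtain r u where r: "r > 0" and u: "u holomorphic_on ball (z0 + h) r"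
    and g: "(\<forall>z\<in>ball (z0 + h) r. g z = Some (u z)) \<or> (\<forall>z\<in>ball (z0 + h) r. g z = oinv (Some (u z)))"
    using assms by (rule smeroE)
  have *: "z + h \<in> ball (z0 + h) r" if "z \<in> ball z0 r" for z
    using that by (simp add: dist_norm)
  have "(u \<circ> (\<lambda>z. z + h)) holomorphic_on ball z0 r"
    using * by (intro holomorphic_on_compose_gen[OF _ u] holomorphic_intros) auto
  then show "\<exists>r>0. \<exists>u. u holomorphic_on ball z0 r \<and>
     ((\<forall>z\<in>ball z0 r. g (z + h) = Some (u z)) \<or> (\<forall>z\<in>ball z0 r. g (z + h) = oinv (Some (u z))))"
    using r g * by (intro exI[of _ r] conjI exI[of _ "\<lambda>z. u (z + h)"]) (auto simp: o_def)
qed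

lemma smero_continuous:
  assumes "smero g" shows "continuous_on S (\<lambda>z. emb (g z))"
proof -
  have "isCont (\<lambda>z. emb (g z)) z0" for z0
  proof -
    obtain r u where r: "r > 0" and u: "u holomorphic_on ball z0 r"
      and g: "(\<forall>z\<in>ball z0 r. g z = Some (u z)) \<or> (\<forall>z\<in>ball z0 r. g z = oinv (Some (u z)))"
      using assms by (rule smeroE)
    have 1: "continuous_on (ball z0 r) (\<lambda>z. emb (Some (u z)))"
      by (intro continuous_on_emb_Some holomorphic_on_imp_continuous_on u)
    note 2 = continuous_on_emb_oinv[OF 1]
    have "continuous_on (ball z0 r) (\<lambda>z. emb (g z))"
      using g
    proof
      assume "\<forall>z\<in>ball z0 r. g z = Some (u z)" with 1 show ?thesis by (subst continuous_on_cong[OF refl, of _ _ "\<lambda>z. emb (Some (u z))"]) auto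
    next
      assume "\<forall>z\<in>ball z0 r. g z = oinv (Some (u z))"
      then show ?thesis using 2 continuous_on_cong[of "ball z0 r" "ball z0 r" "\<lambda>z. emb (g z)" "\<lambda>z. emb (oinv (Some (u z)))"]
        by simp
    qed
    then show ?thesis using r by (simp add: continuous_on_eq_continuous_at)
  qed
  then show ?thesis by (simp add: continuous_at_imp_continuous_on)
qed

lemma smero_holomorphic:
  assumes g: "smero g" and S: "open S" and fin: "\<And>z. z \<in> S \<Longrightarrow> g z \<noteq> None"
  shows "(\<lambda>z. the (g z)) holomorphic_on S"
  unfolding holomorphic_on_open[OF S]
proof
  fix z0 assume z0: "z0 \<in> S"
  obtain r u where r: "r > 0" and u: "u holomorphic_on ball z0 r"
    and gu: "(\<forall>z\<in>ball z0 r. g z = Some (u z)) \<or> (\<forall>z\<in>ball z0 r. g z = oinv (Some (u z)))"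
    using g by (rule smeroE)
  have op: "open (ball z0 r \<inter> S)" and z0': "z0 \<in> ball z0 r \<inter> S" using S r z0 by auto
  have u': "u holomorphic_on ball z0 r \<inter> S" using u by (rule holomorphic_on_subset) auto
  have "(\<lambda>z. the (g z)) holomorphic_on ball z0 r \<inter> S"
    using gu
  proof
    assume "\<forall>z\<in>ball z0 r. g z = Some (u z)"
    then show ?thesis using u' by (subst holomorphic_cong[OF refl, of _ _ u]) auto
  next
    assume gu: "\<forall>z\<in>ball z0 r. g z = oinv (Some (u z))"
    then have nz: "u z \<noteq> 0" if "z \<in> ball z0 r \<inter> S" for z using fin that by fastforce
    then have "(\<lambda>z. 1 / u z) holomorphic_on ball z0 r \<inter> S"
      by (intro holomorphic_intros u') auto
    moreover have "1 / u z = the (g z)" if "z \<in> ball z0 r \<inter> S" for z using gu nz that by auto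
    ultimately show ?thesis by (subst holomorphic_cong[OF refl, of _ _ "\<lambda>z. 1 / u z"]) auto
  qed
  then show "\<exists>f'. ((\<lambda>z. the (g z)) has_field_derivative f') (at z0)"
    using holomorphic_on_open[OF op] z0' by blast
qed

section \<open>Locally uniform convergence in the spherical metric\<close>

text \<open>The convergence in \<open>translate_limit\<close>, for arbitrary sequences of
  sphere-valued maps, so that it also covers reciprocals.\<close>

definition lu_conv :: "(nat \<Rightarrow> complex \<Rightarrow> complex option) \<Rightarrow> (complex \<Rightarrow> complex option) \<Rightarrow> bool" where
  "lu_conv g F \<longleftrightarrow> (\<forall>K. compact K \<longrightarrow> (\<forall>\<epsilon>>0. \<exists>N. \<forall>n\<ge>N. \<forall>z\<in>K. chord (g n z) (F z) < \<epsilon>))"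

lemma lu_convE:
  assumes "lu_conv g F" "compact K" "\<epsilon> > 0"
  obtains N where "\<And>n z. n \<ge> N \<Longrightarrow> z \<in> K \<Longrightarrow> chord (g n z) (F z) < \<epsilon>"
  using assms unfolding lu_conv_def by meson

lemma lu_conv_oinv: "lu_conv g F \<Longrightarrow> lu_conv (\<lambda>n z. oinv (g n z)) (\<lambda>z. oinv (F z))"
  by (simp add: lu_conv_def)

lemma lu_conv_subseq:
  assumes "lu_conv g F" "strict_mono r" shows "lu_conv (\<lambda>n. g (r n)) F"
  using assms unfolding lu_conv_def by (meson order_trans seq_suble)

lemma lu_conv_continuous:
  assumes conv: "lu_conv g F" and g: "\<And>n. smero (g n)"
  shows "isCont (\<lambda>z. emb (F z)) z0"
proof -
  have "uniform_limit (cball z0 1) (\<lambda>n z. emb (g n z)) (\<lambda>z. emb (F z)) sequentially"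
    unfolding uniform_limit_iff eventually_sequentially
    by (metis chord_dist conv compact_cball lu_convE)
  then have "continuous_on (cball z0 1) (\<lambda>z. emb (F z))"
    by (rule uniform_limit_theorem[rotated]) (auto simp: smero_continuous g)
  then show ?thesis
    by (rule continuous_on_interior) simp
qed

lemma continuous_finite_bound:
  assumes cont: "isCont (\<lambda>z. emb (F z)) z0" and fin: "F z0 \<noteq> None"
  obtains r M where "r > 0" "M \<ge> 0" "\<And>z. z \<in> cball z0 r \<Longrightarrow> \<exists>b. F z = Some b \<and> cmod b \<le> M"
proof -
  obtain c where c: "F z0 = Some c" using fin by blast
  define \<eta> where "\<eta> = 1 / sqrt (1 + (cmod c)\<^sup>2)"
  have \<eta>: "\<eta> > 0" unfolding \<eta>_def by (simp add: add_pos_nonneg)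
  obtain r where r: "r > 0" and F: "\<And>z. dist z z0 < r \<Longrightarrow> dist (emb (F z)) (emb (F z0)) < \<eta>"
    using cont \<eta> unfolding continuous_at_eps_delta by metis
  define M where "M = cmod c + \<eta> * (1 + (cmod c)\<^sup>2)"
  have "\<exists>b. F z = Some b \<and> cmod b \<le> M" if "z \<in> cball z0 (r/2)" for z
  proof -
    have "chord (Some c) (F z) \<le> \<eta>"
      using F[of z] that r by (simp add: c chord_dist dist_commute)
    then obtain b where b: "F z = Some b" "cmod (c - b) \<le> \<eta> * (1 + (cmod c)\<^sup>2)"
      using chord_close_finite[of c "cmod c" "F z" \<eta>] \<eta>_def by auto
    then have "cmod b \<le> M" unfolding M_def using norm_triangle_sub[of b c] by (simp add: norm_minus_commute)
    then show ?thesis using b by simp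
  qed
  moreover have "M \<ge> 0" using \<eta> by (simp add: M_def)
  ultimately show ?thesis using that[of "r/2" M] r by auto
qed

text \<open>Where the limit is bounded, chordal and Euclidean distance are comparable, so spherical
  convergence becomes ordinary uniform convergence.\<close>

lemma lu_conv_finite_uniform_limit:
  assumes conv: "lu_conv g F" and K: "compact K"
    and F: "\<And>z. z \<in> K \<Longrightarrow> \<exists>b. F z = Some b \<and> cmod b \<le> M"
  shows "\<forall>\<^sub>F n in sequentially. \<forall>z\<in>K. g n z \<noteq> None"
    and "uniform_limit K (\<lambda>n z. the (g n z)) (\<lambda>z. the (F z)) sequentially"
proof -
  have *: "\<forall>\<^sub>F n in sequentially. \<forall>z\<in>K. g n z \<noteq> None \<and> dist (the (g n z)) (the (F z)) < e" if "e > 0" for e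
  proof -
    \<comment> \<open>The first entry keeps \<open>g n z\<close> finite, the second makes its
      Euclidean distance from the limit at most \<open>e / 2\<close>.\<close>
    define \<eta> where "\<eta> = min (1 / sqrt (1 + M\<^sup>2)) (e / (2 * (1 + M\<^sup>2)))"
    have p: "1 + M\<^sup>2 > 0" by (simp add: add_pos_nonneg)
    then have \<eta>: "\<eta> > 0" using \<open>e > 0\<close> by (simp add: \<eta>_def)
    have "\<eta> * (1 + M\<^sup>2) \<le> e / (2 * (1 + M\<^sup>2)) * (1 + M\<^sup>2)"
      unfolding \<eta>_def by (intro mult_right_mono) auto
    also have "\<dots> = e / 2" using p by (metis less_irrefl mult.commute nonzero_eq_divide_eq divide_divide_eq_left times_divide_eq_left)
    finally have \<eta>e: "\<eta> * (1 + M\<^sup>2) < e" using \<open>e > 0\<close> by simp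
    obtain N where N: "\<And>n z. n \<ge> N \<Longrightarrow> z \<in> K \<Longrightarrow> chord (g n z) (F z) < \<eta>"
      using lu_convE[OF conv K \<eta>] by blast
    have "g n z \<noteq> None \<and> dist (the (g n z)) (the (F z)) < e" if "n \<ge> N" "z \<in> K" for n z
    proof -
      obtain a where a: "F z = Some a" "cmod a \<le> M" using F \<open>z \<in> K\<close> by blast
      have "chord (Some a) (g n z) \<le> \<eta>" using N[OF that] a by (simp add: chord_commute)
      then obtain b where "g n z = Some b" "cmod (a - b) \<le> \<eta> * (1 + M\<^sup>2)"
        using chord_close_finite[OF a(2), of "g n z" \<eta>] by (auto simp: \<eta>_def)
      then show ?thesis using \<eta>e a by (simp add: dist_norm norm_minus_commute)
    qed
    then show ?thesis unfolding eventually_sequentially by blast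
  qed
  show "\<forall>\<^sub>F n in sequentially. \<forall>z\<in>K. g n z \<noteq> None"
    using *[of 1] by (auto elim: eventually_mono)
  show "uniform_limit K (\<lambda>n z. the (g n z)) (\<lambda>z. the (F z)) sequentially"
    unfolding uniform_limit_iff 
    by (intro allI impI) (rule eventually_mono[OF *], auto)
qed

text \<open>Near a finite value the limit is bounded, so Weierstrass' theorem on uniform limits of
  holomorphic functions applies.\<close>

lemma lu_conv_local_holomorphic:
  assumes conv: "lu_conv g F" and g: "\<And>n. smero (g n)" and fin: "F z0 \<noteq> None"
  shows "\<exists>r>0. \<exists>u. u holomorphic_on ball z0 r \<and> (\<forall>z\<in>ball z0 r. F z = Some (u z))"
proof -
  obtain r M where r: "r > 0" and M: "\<And>z. z \<in> cball z0 r \<Longrightarrow> \<exists>b. F z = Some b \<and> cmod b \<le> M"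
    using continuous_finite_bound[OF lu_conv_continuous[OF conv g] fin] by metis
  have fin: "\<forall>\<^sub>F n in sequentially. \<forall>z\<in>cball z0 r. g n z \<noteq> None"
    and lim: "uniform_limit (cball z0 r) (\<lambda>n z. the (g n z)) (\<lambda>z. the (F z)) sequentially"
    using lu_conv_finite_uniform_limit[OF conv compact_cball M] by auto
  define s where "s = r / 2"
  have s: "s > 0" "cball z0 s \<subseteq> ball z0 r" "cball z0 s \<subseteq> cball z0 r" using r by (auto simp: s_def)
  have "\<forall>\<^sub>F n in sequentially. continuous_on (cball z0 s) (\<lambda>z. the (g n z)) \<and> (\<lambda>z. the (g n z)) holomorphic_on ball z0 s"
    using fin
  proof eventually_elim
    case (elim n)
    have "(\<lambda>z. the (g n z)) holomorphic_on ball z0 r"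
      by (rule smero_holomorphic[OF g]) (use elim in auto)
    then show ?case
      by (meson s ball_subset_cball holomorphic_on_imp_continuous_on holomorphic_on_subset order_trans)
  qed
  then have "(\<lambda>z. the (F z)) holomorphic_on ball z0 s"
    by (rule holomorphic_uniform_limit[OF _ uniform_limit_on_subset[OF lim s(3)]]) auto
  moreover have "F z = Some (the (F z))" if "z \<in> ball z0 s" for z
    using M[of z] that s by force
  ultimately show ?thesis using s(1) by blast
qed

text \<open>Near a point where the limit is infinite, the local result is applied to the
  reciprocals, whose limit is finite there.\<close>

lemma smero_limit:
  assumes conv: "lu_conv g F" and g: "\<And>n. smero (g n)"
  shows "smero F"
  unfolding smero_def
proof
  fix z0
  show "\<exists>r>0. \<exists>u. u holomorphic_on ball z0 r \<and>
     ((\<forall>z\<in>ball z0 r. F z = Some (u z)) \<or> (\<forall>z\<in>ball z0 r. F z = oinv (Some (u z))))"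
  proof (cases "F z0 = None")
    case False
    then show ?thesis using lu_conv_local_holomorphic[OF conv g] by blast
  next
    case True
    then have "oinv (F z0) \<noteq> None" by simp
    then obtain r u where "r > 0" "u holomorphic_on ball z0 r" "\<forall>z\<in>ball z0 r. oinv (F z) = Some (u z)"
      using lu_conv_local_holomorphic[OF lu_conv_oinv[OF conv] smero_oinv[OF g]] by blast
    then show ?thesis by (metis oinv_oinv)
  qed
qed

section \<open>Isolation of zeros and poles\<close>

text \<open>The identity theorem on the connected plane: the interior \<open>A\<close> of the zero
  set contains every limit point of zeros, so it is open and closed.\<close>

lemma smero_zeros_isolated:
  assumes F: "smero F" and lim: "z0 islimpt {z. F z = Some 0}"
  shows "F z = Some 0"
proof -
  define A where "A = {z. \<exists>r>0. \<forall>w\<in>ball z r. F w = Some 0}"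
  have inA: "z0 \<in> A" if lim: "z0 islimpt {z. F z = Some 0}" for z0
  proof -
    obtain r u where r: "r > 0" and u: "u holomorphic_on ball z0 r"
      and Fu: "(\<forall>z\<in>ball z0 r. F z = Some (u z)) \<or> (\<forall>z\<in>ball z0 r. F z = oinv (Some (u z)))"
      using F by (rule smeroE)
    have lim': "z0 islimpt {z\<in>ball z0 r. F z = Some 0}"
    proof (rule islimptI)
      fix T assume T: "z0 \<in> T" "open T"
      show "\<exists>y\<in>{z \<in> ball z0 r. F z = Some 0}. y \<in> T \<and> y \<noteq> z0"
        using islimptE[OF lim, of "T \<inter> ball z0 r"] T r by (auto simp: open_Int)
    qed
    then obtain w where "w \<in> ball z0 r" "F w = Some 0" 
      using islimptE[OF lim', of UNIV] by auto
    \<comment> \<open>A value \<open>oinv (Some c)\<close> is never \<open>Some 0\<close>, so a zero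
      in the disc forces the holomorphic representation of \<open>F\<close> there.\<close>
    then have "F w \<noteq> oinv (Some (u w))" by (metis oinv_eq_Some_0_iff option.distinct(1))
    then have Fu: "\<forall>z\<in>ball z0 r. F z = Some (u z)" using Fu \<open>w \<in> ball z0 r\<close> by blast
    have "u w = 0" if "w \<in> ball z0 r" for w
      by (rule analytic_continuation[OF u open_ball _ _ _ lim']) (use r Fu that in \<open>auto intro: convex_connected\<close>)
    then show "z0 \<in> A" using r Fu unfolding A_def by auto
  qed
  have "open A"
    unfolding open_contains_ball
  proof
    fix x assume "x \<in> A"
    then obtain r where r: "r > 0" "\<forall>w\<in>ball x r. F w = Some 0" unfolding A_def by blast
    have "ball x r \<subseteq> A"
    proof
      fix y assume "y \<in> ball x r"
      then obtain s where "s > 0" "ball y s \<subseteq> ball x r" using openE[OF open_ball] by blast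
      then show "y \<in> A" using r unfolding A_def by blast
    qed
    with r show "\<exists>e>0. ball x e \<subseteq> A" by blast
  qed
  moreover have "closed A"
    unfolding closed_limpt
  proof (intro allI impI)
    fix x assume "x islimpt A"
    then have "x islimpt {z. F z = Some 0}"
      by (rule islimpt_subset) (auto simp: A_def)
    then show "x \<in> A" by (rule inA)
  qed
  ultimately have "A = UNIV" using inA[OF lim] by (metis clopen empty_iff)
  then show ?thesis unfolding A_def using centre_in_ball by blast
qed

lemma smero_poles_isolated:
  assumes "smero F" and "z0 islimpt {z. F z = None}"
  shows "F z = None"
  using smero_zeros_isolated[OF smero_oinv, of F z0 z] assms by simp

lemma smero_good_circle:
  assumes F: "smero F" "\<And>c. F \<noteq> (\<lambda>_. c)" and G: "smero G" "\<And>c. G \<noteq> (\<lambda>_. c)" and R: "R > 0"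
  obtains \<rho> where "0 < \<rho>" "\<rho> < R"
    "\<And>z. z \<in> sphere 0 \<rho> \<Longrightarrow> F z \<noteq> None \<and> F z \<noteq> Some 0 \<and> G z \<noteq> None \<and> G z \<noteq> Some 0"
proof -
  define B where "B = {z. F z = None} \<union> {z. F z = Some 0} \<union> {z. G z = None} \<union> {z. G z = Some 0}"
  have "\<not> 0 islimpt B"
    unfolding B_def islimpt_Un
    using smero_zeros_isolated[OF F(1)] smero_poles_isolated[OF F(1)]
      smero_zeros_isolated[OF G(1)] smero_poles_isolated[OF G(1)] F(2) G(2) by blast
  then obtain e where e: "e > 0" "\<And>z. z \<in> B \<Longrightarrow> z \<noteq> 0 \<Longrightarrow> \<not> dist z 0 < e"
    unfolding islimpt_approachable by blast
  \<comment> \<open>Only the centre of the disc of radius \<open>e\<close> may be a zero or pole, so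
    every smaller circle avoids them.\<close>
  define \<rho> where "\<rho> = min e R / 2"
  have "0 < \<rho>" "\<rho> < R" "\<rho> < e" using e R by (auto simp: \<rho>_def)
  moreover have "z \<notin> B" if "z \<in> sphere 0 \<rho>" for z using e(2)[of z] that calculation by auto
  ultimately show ?thesis using that[of \<rho>] unfolding B_def by simp
qed

section \<open>From closeness on a circle to closeness at its centre\<close>

lemma max_principle_disc:
  assumes "\<rho> > 0" and S: "open S" "cball 0 \<rho> \<subseteq> S" and u: "u holomorphic_on S"
    and B: "\<And>z. z \<in> sphere 0 \<rho> \<Longrightarrow> cmod (u z) \<le> B" and z: "z \<in> cball 0 \<rho>"
  shows "cmod (u z) \<le> B"
proof (rule maximum_modulus_frontier[of u "cball 0 \<rho>"])
  show "u holomorphic_on interior (cball 0 \<rho>)"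
    using u by (rule holomorphic_on_subset) (use S interior_subset in blast)
  show "continuous_on (closure (cball 0 \<rho>)) u"
    using u S by (metis closed_cball closure_closed holomorphic_on_imp_continuous_on continuous_on_subset)
qed (use assms in \<open>auto simp: frontier_cball\<close>)

text \<open>Finiteness is an open condition, because \<open>emb\<close> composed with
  \<open>g\<close> is continuous. The neighbourhood provides continuity up to the boundary of a
  closed disc, as the maximum principle requires.\<close>

lemma pole_free_neighbourhood:
  assumes g: "smero g" and K: "\<And>z. z \<in> K \<Longrightarrow> g z \<noteq> None"
  obtains S where "open S" "K \<subseteq> S" "(\<lambda>z. the (g z)) holomorphic_on S" "\<And>z. z \<in> S \<Longrightarrow> g z \<noteq> None"
proof -
  define S where "S = (\<lambda>z. emb (g z)) -` (- {emb None})"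
  have "open S" unfolding S_def
    by (intro open_vimage smero_continuous[OF g]) auto
  moreover have ne: "g z \<noteq> None" if "z \<in> S" for z
    using that unfolding S_def by (metis ComplD insertCI vimageE)
  moreover have "K \<subseteq> S"
    using K by (auto simp: S_def emb_eq_iff simp del: emb.simps)
  ultimately show ?thesis using that smero_holomorphic[OF g] by blast
qed

lemma disc_close_pole_free:
  assumes g: "smero g1" "smero g2" and \<rho>: "\<rho> > 0"
    and pf: "\<And>z. z \<in> cball 0 \<rho> \<Longrightarrow> g1 z \<noteq> None \<and> g2 z \<noteq> None"
    and circ: "\<And>z. z \<in> sphere 0 \<rho> \<Longrightarrow> cmod (the (g1 z) - the (g2 z)) \<le> \<eta>"
  shows "chord (g1 0) (g2 0) \<le> 2 * \<eta>"
proof -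
  obtain S1 where S1: "open S1" "cball 0 \<rho> \<subseteq> S1" "(\<lambda>z. the (g1 z)) holomorphic_on S1"
    using pole_free_neighbourhood[OF g(1), of "cball 0 \<rho>"] pf by metis
  obtain S2 where S2: "open S2" "cball 0 \<rho> \<subseteq> S2" "(\<lambda>z. the (g2 z)) holomorphic_on S2"
    using pole_free_neighbourhood[OF g(2), of "cball 0 \<rho>"] pf by metis
  have "(\<lambda>z. the (g1 z) - the (g2 z)) holomorphic_on S1 \<inter> S2"
    using S1 S2 by (intro holomorphic_on_diff) (auto elim: holomorphic_on_subset)
  then have "cmod (the (g1 0) - the (g2 0)) \<le> \<eta>"
    by (rule max_principle_disc[OF \<rho>, rotated 2, OF _ circ]) (use S1 S2 \<rho> in auto)
  moreover have "g1 0 = Some (the (g1 0))" "g2 0 = Some (the (g2 0))" using pf[of 0] \<rho> by auto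
  ultimately show ?thesis using chord_Some_le[of "the (g1 0)" "the (g2 0)"] by simp
qed

text \<open>Rules out that of two functions close to each other on a circle one has only zeros inside and the other only
  poles: the product of the first with the reciprocal of the second is holomorphic and close to 1.\<close>

lemma disc_no_mixed:
  assumes g: "smero g1" "smero g2" and \<rho>: "\<rho> > 0"
    and pf: "\<And>z. z \<in> cball 0 \<rho> \<Longrightarrow> g1 z \<noteq> None \<and> g2 z \<noteq> Some 0"
    and circ: "\<And>z. z \<in> sphere 0 \<rho> \<Longrightarrow> cmod (the (g1 z) * the (oinv (g2 z)) - 1) \<le> \<eta>"
    and \<eta>: "\<eta> < 1" and z: "z \<in> cball 0 \<rho>"
  shows "g1 z \<noteq> Some 0"
proof
  assume g0: "g1 z = Some 0"
  have g2: "smero (\<lambda>z. oinv (g2 z))" by (rule smero_oinv[OF g(2)])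
  obtain S1 where S1: "open S1" "cball 0 \<rho> \<subseteq> S1" "(\<lambda>z. the (g1 z)) holomorphic_on S1"
    using pole_free_neighbourhood[OF g(1), of "cball 0 \<rho>"] pf by metis
  obtain S2 where S2: "open S2" "cball 0 \<rho> \<subseteq> S2" "(\<lambda>z. the (oinv (g2 z))) holomorphic_on S2"
    using pole_free_neighbourhood[OF g2, of "cball 0 \<rho>"] pf oinv_eq_None_iff by metis
  have "(\<lambda>z. the (g1 z) * the (oinv (g2 z)) - 1) holomorphic_on S1 \<inter> S2"
    using S1 S2 by (intro holomorphic_intros) (auto elim: holomorphic_on_subset)
  then have "cmod (the (g1 z) * the (oinv (g2 z)) - 1) \<le> \<eta>"
    by (rule max_principle_disc[OF \<rho>, rotated 2, OF _ circ]) (use S1 S2 \<rho> z in auto)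
  then show False using g0 \<eta> by simp
qed

text \<open>If both functions are free of poles, their difference obeys the maximum principle; if
  both are free of zeros, their reciprocals do. In the mixed case the pole-free function has no
  zeros either by \<open>disc_no_mixed\<close>, so both are free of zeros.\<close>

lemma disc_close:
  assumes g: "smero g1" "smero g2" and \<rho>: "\<rho> > 0"
    and sep: "(\<forall>z\<in>cball 0 \<rho>. g1 z \<noteq> None) \<or> (\<forall>z\<in>cball 0 \<rho>. g1 z \<noteq> Some 0)"
      "(\<forall>z\<in>cball 0 \<rho>. g2 z \<noteq> None) \<or> (\<forall>z\<in>cball 0 \<rho>. g2 z \<noteq> Some 0)"
    and circ: "\<And>z. z \<in> sphere 0 \<rho> \<Longrightarrow> \<exists>a b. g1 z = Some a \<and> g2 z = Some b \<and> m \<le> cmod a \<and> m \<le> cmod b \<and> cmod (a - b) \<le> \<eta>"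
    and m: "0 < m" "m \<le> 1" and \<eta>: "\<eta> < m"
  shows "chord (g1 0) (g2 0) \<le> 2 * \<eta> / m\<^sup>2"
proof -
  have "sphere 0 \<rho> \<noteq> ({}::complex set)" using \<rho> by simp
  then obtain z0 :: complex where "z0 \<in> sphere 0 \<rho>" by blast
  then have \<eta>0: "\<eta> \<ge> 0" using circ[of z0] norm_ge_zero order_trans by blast
  \<comment> \<open>Since \<open>m \<le> 1\<close>, the bound for the pole-free case is absorbed by
    the weaker one for reciprocals.\<close>
  have le: "2 * \<eta> \<le> 2 * \<eta> / m\<^sup>2"
    using \<eta>0 m power_le_one[of m 2] by (simp add: field_simps mult_left_le)
  have both: "chord (g1 0) (g2 0) \<le> 2 * \<eta> / m\<^sup>2" if "\<And>z. z \<in> cball 0 \<rho> \<Longrightarrow> g1 z \<noteq> Some 0 \<and> g2 z \<noteq> Some 0"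
  proof -
    have "chord (oinv (g1 0)) (oinv (g2 0)) \<le> 2 * (\<eta> / m\<^sup>2)"
    proof (rule disc_close_pole_free[OF smero_oinv[OF g(1)] smero_oinv[OF g(2)] \<rho>])
      fix z :: complex assume "z \<in> sphere 0 \<rho>"
      then obtain a b where ab: "g1 z = Some a" "g2 z = Some b" "m \<le> cmod a" "m \<le> cmod b" "cmod (a - b) \<le> \<eta>"
        using circ by blast
      then have nz: "a \<noteq> 0" "b \<noteq> 0" using m by auto
      have "cmod (1 / a - 1 / b) = cmod (a - b) / (cmod a * cmod b)"
        using nz by (simp add: diff_frac_eq norm_divide norm_mult norm_minus_commute)
      also have "\<dots> \<le> \<eta> / (m * m)"
        using ab m \<eta>0 by (intro frac_le mult_mono) auto
      finally show "cmod (the (oinv (g1 z)) - the (oinv (g2 z))) \<le> \<eta> / m\<^sup>2"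
        using ab nz by (simp add: power2_eq_square)
    qed (use that in auto)
    then show ?thesis by simp
  qed
  have mixed: "g1 z \<noteq> Some 0" if g: "smero g1" "smero g2"
    and h: "\<And>z. z \<in> cball 0 \<rho> \<Longrightarrow> g1 z \<noteq> None \<and> g2 z \<noteq> Some 0" and z: "z \<in> cball 0 \<rho>"
    and circ: "\<And>z. z \<in> sphere 0 \<rho> \<Longrightarrow> \<exists>a b. g1 z = Some a \<and> g2 z = Some b \<and> m \<le> cmod a \<and> m \<le> cmod b \<and> cmod (a - b) \<le> \<eta>"
    for g1 g2 z
  proof (rule disc_no_mixed[OF g \<rho> h _ _ z])
    show "\<eta> / m < 1" using \<eta> m by simp
    fix z :: complex assume "z \<in> sphere 0 \<rho>"
    then obtain a b where ab: "g1 z = Some a" "g2 z = Some b" "m \<le> cmod a" "m \<le> cmod b" "cmod (a - b) \<le> \<eta>"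
      using circ by blast
    then have nz: "b \<noteq> 0" using m by auto
    have "cmod (a * (1 / b) - 1) = cmod (a - b) / cmod b"
      using nz by (metis diff_divide_distrib divide_self norm_divide times_divide_eq_right mult.right_neutral)
    also have "\<dots> \<le> \<eta> / m" using ab m \<eta>0 by (intro frac_le) auto
    finally show "cmod (the (g1 z) * the (oinv (g2 z)) - 1) \<le> \<eta> / m" using ab nz by simp
  qed auto
  have circ': "\<exists>a b. g2 z = Some a \<and> g1 z = Some b \<and> m \<le> cmod a \<and> m \<le> cmod b \<and> cmod (a - b) \<le> \<eta>" if "z \<in> sphere 0 \<rho>" for z
    using circ[OF that] by (metis norm_minus_commute)
  show ?thesis
  proof (cases "(\<forall>z\<in>cball 0 \<rho>. g1 z \<noteq> None) \<and> (\<forall>z\<in>cball 0 \<rho>. g2 z \<noteq> None)")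
    case True
    have "chord (g1 0) (g2 0) \<le> 2 * \<eta>"
      by (rule disc_close_pole_free[OF g \<rho>]) (use True circ in fastforce)+
    with le show ?thesis by linarith
  next
    case False
    have 1: "g1 z \<noteq> Some 0" if "\<forall>z\<in>cball 0 \<rho>. g1 z \<noteq> None" "\<forall>z\<in>cball 0 \<rho>. g2 z \<noteq> Some 0" "z \<in> cball 0 \<rho>" for z
      by (rule mixed[OF g _ that(3) circ]) (use that in auto)
    have 2: "g2 z \<noteq> Some 0" if "\<forall>z\<in>cball 0 \<rho>. g2 z \<noteq> None" "\<forall>z\<in>cball 0 \<rho>. g1 z \<noteq> Some 0" "z \<in> cball 0 \<rho>" for z
      by (rule mixed[OF g(2) g(1) _ that(3) circ']) (use that in auto)
    show ?thesis
      by (rule both) (use False sep 1 2 in blast)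
  qed
qed

section \<open>The class of normal functions without constant limits\<close>

text \<open>Normality is stated for sphere-valued maps so that reciprocals can be taken without
  returning to complex-valued representatives.\<close>

definition normal_s :: "(complex \<Rightarrow> complex option) \<Rightarrow> bool" where
  "normal_s s \<longleftrightarrow> (\<forall>h :: nat \<Rightarrow> complex. \<exists>r :: nat \<Rightarrow> nat. strict_mono r \<and>
     (\<forall>K. compact K \<longrightarrow> (\<forall>\<epsilon>>0. \<exists>N. \<forall>m\<ge>N. \<forall>n\<ge>N. \<forall>z\<in>K.
        chord (s (z + h (r m))) (s (z + h (r n))) < \<epsilon>)))"

definition N1s :: "(complex \<Rightarrow> complex option) \<Rightarrow> bool" where
  "N1s s \<longleftrightarrow> smero s \<and> normal_s s \<and> \<not> (\<exists>h c. lu_conv (\<lambda>n z. s (z + h n)) (\<lambda>_. c))"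

text \<open>The sphere is complete, so a subsequence that is uniformly Cauchy on compacta has a
  pointwise limit, and the Cauchy estimate makes the convergence uniform on compacta.\<close>

lemma normal_s_limit:
  assumes "normal_s s"
  obtains r F where "strict_mono (r :: nat \<Rightarrow> nat)" "lu_conv (\<lambda>n z. s (z + h (r n))) F"
proof -
  obtain r :: "nat \<Rightarrow> nat" where r: "strict_mono r"
    and rC: "\<forall>K. compact K \<longrightarrow> (\<forall>\<epsilon>>0. \<exists>N. \<forall>m\<ge>N. \<forall>n\<ge>N. \<forall>z\<in>K.
        chord (s (z + h (r m))) (s (z + h (r n))) < \<epsilon>)"
    using assms unfolding normal_s_def by blast
  have C: "\<exists>N. \<forall>m\<ge>N. \<forall>n\<ge>N. \<forall>z\<in>K. chord (s (z + h (r m))) (s (z + h (r n))) < \<epsilon>"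
    if "compact K" "\<epsilon> > 0" for K \<epsilon> using rC that by blast
  have "\<exists>x. (\<lambda>n. emb (s (z + h (r n)))) \<longlonglongrightarrow> emb x" for z
  proof -
    have "Cauchy (\<lambda>n. emb (s (z + h (r n))))"
      unfolding Cauchy_def using C[of "{z}"] by (simp add: chord_dist)
    then obtain l where l: "(\<lambda>n. emb (s (z + h (r n)))) \<longlonglongrightarrow> l"
      using Cauchy_convergent_iff convergent_def by blast
    have "l \<in> sphere 0 1"
      by (rule closed_sequentially[OF closed_sphere _ l]) (simp add: norm_emb)
    then obtain x where "l = emb x" unfolding range_emb[symmetric] by blast
    with l show ?thesis by blast
  qed
  then obtain F where F: "\<And>z. (\<lambda>n. emb (s (z + h (r n)))) \<longlonglongrightarrow> emb (F z)" by metis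
  have "lu_conv (\<lambda>n z. s (z + h (r n))) F"
    unfolding lu_conv_def
  proof (intro allI impI)
    fix K :: "complex set" and \<epsilon> :: real assume K: "compact K" and \<epsilon>: "\<epsilon> > 0"
    then obtain N where N: "\<And>m n z. m \<ge> N \<Longrightarrow> n \<ge> N \<Longrightarrow> z \<in> K \<Longrightarrow>
        chord (s (z + h (r m))) (s (z + h (r n))) < \<epsilon> / 2"
      using C[of K "\<epsilon> / 2"] by auto
    have "chord (s (z + h (r n))) (F z) < \<epsilon>" if "n \<ge> N" "z \<in> K" for n z
    proof -
      \<comment> \<open>Letting \<open>m\<close> tend to infinity in the Cauchy estimate gives a
        bound independent of \<open>z\<close>.\<close>
      have "(\<lambda>m. dist (emb (s (z + h (r n)))) (emb (s (z + h (r m))))) \<longlonglongrightarrow> dist (emb (s (z + h (r n)))) (emb (F z))"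
        by (intro tendsto_intros F)
      moreover have "\<forall>\<^sub>F m in sequentially. dist (emb (s (z + h (r n)))) (emb (s (z + h (r m)))) \<le> \<epsilon> / 2"
        using N[OF that(1) _ that(2)] unfolding eventually_sequentially chord_dist by (meson less_imp_le)
      ultimately have "dist (emb (s (z + h (r n)))) (emb (F z)) \<le> \<epsilon> / 2"
        by (rule tendsto_upperbound) simp
      then show ?thesis using \<epsilon> by (simp add: chord_dist)
    qed
    then show "\<exists>N. \<forall>n\<ge>N. \<forall>z\<in>K. chord (s (z + h (r n))) (F z) < \<epsilon>" by blast
  qed
  with r that show ?thesis by blast
qed

lemma N1s_limit:
  assumes s: "N1s s"
  obtains r F where "strict_mono (r :: nat \<Rightarrow> nat)" "lu_conv (\<lambda>n z. s (z + h (r n))) F"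
    "smero F" "\<And>c. F \<noteq> (\<lambda>_. c)"
proof -
  obtain r F where rF: "strict_mono (r :: nat \<Rightarrow> nat)" "lu_conv (\<lambda>n z. s (z + h (r n))) F"
    using s normal_s_limit unfolding N1s_def by blast
  have "smero F" using smero_limit[OF rF(2)] s unfolding N1s_def by (simp add: smero_translate)
  moreover have "F \<noteq> (\<lambda>_. c)" for c
    using s rF(2) unfolding N1s_def by (auto intro: exI[of _ "\<lambda>n. h (r n)"])
  ultimately show ?thesis using rF that by blast
qed

lemma N1s_oinv:
  assumes "N1s s" shows "N1s (\<lambda>z. oinv (s z))"
proof -
  have "\<not> lu_conv (\<lambda>n z. oinv (s (z + h n))) (\<lambda>_. c)" for h c
    using assms lu_conv_oinv[of "\<lambda>n z. oinv (s (z + h n))" "\<lambda>_. c"] unfolding N1s_def by auto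
  then show ?thesis using assms unfolding N1s_def normal_s_def by (simp add: smero_oinv)
qed

section \<open>Closeness of the factors implies closeness of the product\<close>

lemma smero_compact_bounded:
  assumes F: "smero F" and K: "compact K" and fin: "\<And>z. z \<in> K \<Longrightarrow> F z \<noteq> None"
  shows "\<exists>M. \<forall>z\<in>K. cmod (the (F z)) \<le> M"
proof -
  obtain S where "open S" "K \<subseteq> S" "(\<lambda>z. the (F z)) holomorphic_on S"
    using pole_free_neighbourhood[OF F fin] by metis
  then have "continuous_on K (\<lambda>z. the (F z))"
    using holomorphic_on_imp_continuous_on continuous_on_subset by blast
  then have "bounded ((\<lambda>z. the (F z)) ` K)" using K compact_continuous_image compact_imp_bounded by blast
  then show ?thesis unfolding bounded_iff by blast
qed

text \<open>The bounds hold for every \<open>M' \<ge> M\<close>, so that two functions can share one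
  constant.\<close>

lemma smero_compact_bounds:
  assumes F: "smero F" and K: "compact K" and fin: "\<And>z. z \<in> K \<Longrightarrow> F z \<noteq> None \<and> F z \<noteq> Some 0"
  obtains M where "M \<ge> 1" "\<And>z M'. z \<in> K \<Longrightarrow> M' \<ge> M \<Longrightarrow> \<exists>a. F z = Some a \<and> 1 / M' \<le> cmod a \<and> cmod a \<le> M'"
proof -
  obtain M1 where M1: "\<And>z. z \<in> K \<Longrightarrow> cmod (the (F z)) \<le> M1"
    using smero_compact_bounded[OF F K] fin by blast
  obtain M2 where M2: "\<And>z. z \<in> K \<Longrightarrow> cmod (the (oinv (F z))) \<le> M2"
    using smero_compact_bounded[OF smero_oinv[OF F] K] fin oinv_eq_None_iff by metis
  show ?thesis
  proof (rule that[of "max 1 (max M1 M2)"])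
    fix z M' assume z: "z \<in> K" and M': "max 1 (max M1 M2) \<le> M'"
    obtain a where a: "F z = Some a" "a \<noteq> 0" using fin[OF z] by auto
    have "1 / cmod a \<le> M'" using M2[OF z] a M' by (simp add: norm_divide)
    then have "1 / M' \<le> cmod a" using a M' by (simp add: field_simps)
    then show "\<exists>a. F z = Some a \<and> 1 / M' \<le> cmod a \<and> cmod a \<le> M'"
      using M1[OF z] a M' by auto
  qed simp
qed

lemma lu_conv_close_bounds:
  assumes conv: "lu_conv g F" and K: "compact K" and M: "M \<ge> 1"
    and F: "\<forall>z\<in>K. \<exists>a. F z = Some a \<and> 1 / M \<le> cmod a \<and> cmod a \<le> M"
    and e: "0 < e" "e \<le> 1 / (2 * M)"
  shows "\<forall>\<^sub>F n in sequentially. \<forall>z\<in>K. \<exists>a. g n z = Some a \<and> 1 / (2 * M) \<le> cmod a \<and> cmod a \<le> 2 * M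
    \<and> cmod (a - the (F z)) \<le> e"
proof -
  have F': "\<exists>b. F z = Some b \<and> cmod b \<le> M" if "z \<in> K" for z using F that by blast
  have "\<forall>\<^sub>F n in sequentially. \<forall>z\<in>K. dist (the (g n z)) (the (F z)) < e"
    using lu_conv_finite_uniform_limit(2)[OF conv K F'] e unfolding uniform_limit_iff by blast
  moreover have "\<forall>\<^sub>F n in sequentially. \<forall>z\<in>K. g n z \<noteq> None"
    using lu_conv_finite_uniform_limit(1)[OF conv K F'] .
  ultimately show ?thesis
  proof eventually_elim
    case (elim n)
    show ?case
    proof
      fix z assume z: "z \<in> K"
      obtain b where b: "F z = Some b" "1 / M \<le> cmod b" "cmod b \<le> M" using F z by blast
      obtain a where a: "g n z = Some a" using elim z by fastforce
      have d: "cmod (a - b) < e" using elim z a b by (auto simp: dist_norm)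
      have h: "1 / M = 1 / (2 * M) + 1 / (2 * M)" using M by (simp add: field_simps)
      have "1 / (2 * M) \<le> cmod a" using d b e h norm_triangle_ineq2[of b a] norm_minus_commute[of a b] by linarith
      moreover have "1 / (2 * M) \<le> 1" using M by simp
      then have "cmod a \<le> 2 * M" using d b e M norm_triangle_ineq2[of a b] by linarith
      ultimately show "\<exists>a. g n z = Some a \<and> 1 / (2 * M) \<le> cmod a \<and> cmod a \<le> 2 * M \<and> cmod (a - the (F z)) \<le> e"
        using a d b by simp
    qed
  qed
qed

lemma separated_disc:
  assumes sep: "\<And>a b. p a = Some 0 \<Longrightarrow> p b = None \<Longrightarrow> \<delta> \<le> cmod (a - b)" and \<rho>: "2 * \<rho> < \<delta>"
  shows "(\<forall>z\<in>cball 0 \<rho>. p (z + h) \<noteq> None) \<or> (\<forall>z\<in>cball 0 \<rho>. p (z + h) \<noteq> Some 0)"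
proof (rule ccontr)
  assume "\<not> ?thesis"
  then obtain z w where "z \<in> cball 0 \<rho>" "w \<in> cball 0 \<rho>" "p (z + h) = None" "p (w + h) = Some 0" by blast
  then have "\<delta> \<le> cmod (w - z)" "cmod z \<le> \<rho>" "cmod w \<le> \<rho>" using sep[of "w + h" "z + h"] by auto
  then show False using \<rho> norm_triangle_ineq4[of w z] by linarith
qed

text \<open>The point is that \<open>\<eta>\<close> and \<open>R\<close> do not depend on the
  shifts. A failure for all of them gives shifts \<open>h n\<close>, \<open>k n\<close> along which
  both factors have common nonconstant limits. On a circle where these limits are finite and nonzero
  \<open>mult\<close> applies, and \<open>disc_close\<close> carries the estimate for the product to
  the centre.\<close>

lemma product_close:
  assumes s1: "N1s s1" and s2: "N1s s2" and p: "smero p"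
    and mult: "\<And>z a b. s1 z = Some a \<Longrightarrow> s2 z = Some b \<Longrightarrow> p z = Some (a * b)"
    and \<delta>: "\<delta> > 0" and sep: "\<And>a b. p a = Some 0 \<Longrightarrow> p b = None \<Longrightarrow> \<delta> \<le> cmod (a - b)"
    and \<epsilon>: "\<epsilon> > 0"
  shows "\<exists>\<eta>>0. \<exists>R. \<forall>h k.
    (\<forall>z\<in>cball 0 R. chord (s1 (z + h)) (s1 (z + k)) < \<eta> \<and> chord (s2 (z + h)) (s2 (z + k)) < \<eta>)
      \<longrightarrow> chord (p h) (p k) < \<epsilon>"
proof (rule ccontr)
  assume "\<not> ?thesis"
  then have "\<exists>h k. (\<forall>z\<in>cball 0 R. chord (s1 (z + h)) (s1 (z + k)) < \<eta> \<and> chord (s2 (z + h)) (s2 (z + k)) < \<eta>)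
      \<and> chord (p h) (p k) \<ge> \<epsilon>" if "\<eta> > 0" for \<eta> R
    using that unfolding not_less[symmetric] by blast
  \<comment> \<open>Radius \<open>n\<close> with tolerance \<open>1 / Suc n\<close>: on each compact
    set the two translates become indistinguishable.\<close>
  then have "\<forall>n. \<exists>h k. (\<forall>z\<in>cball 0 (real n). chord (s1 (z + h)) (s1 (z + k)) < 1 / real (Suc n)
      \<and> chord (s2 (z + h)) (s2 (z + k)) < 1 / real (Suc n)) \<and> chord (p h) (p k) \<ge> \<epsilon>"
    by simp
  then obtain h k where
    hk: "\<And>n z. z \<in> cball 0 (real n) \<Longrightarrow> chord (s1 (z + h n)) (s1 (z + k n)) < 1 / real (Suc n)"
      "\<And>n z. z \<in> cball 0 (real n) \<Longrightarrow> chord (s2 (z + h n)) (s2 (z + k n)) < 1 / real (Suc n)"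
    and far: "\<And>n. chord (p (h n)) (p (k n)) \<ge> \<epsilon>"
    by metis
  obtain r1 F1 where r1: "strict_mono r1" and F1: "lu_conv (\<lambda>n z. s1 (z + h (r1 n))) F1" "smero F1" "\<And>c. F1 \<noteq> (\<lambda>_. c)"
    using N1s_limit[OF s1, of h] by metis
  obtain r2 F2 where r2: "strict_mono r2" and F2: "lu_conv (\<lambda>n z. s2 (z + h (r1 (r2 n)))) F2" "smero F2" "\<And>c. F2 \<noteq> (\<lambda>_. c)"
    using N1s_limit[OF s2, of "\<lambda>n. h (r1 n)"] by blast
  define r where "r = r1 \<circ> r2"
  have r: "strict_mono r" unfolding r_def using r1 r2 by (rule strict_mono_o)
  have c1: "lu_conv (\<lambda>n z. s1 (z + h (r n))) F1"
    using lu_conv_subseq[OF F1(1) r2] by (simp add: r_def)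
  have c2: "lu_conv (\<lambda>n z. s2 (z + h (r n))) F2"
    using F2(1) by (simp add: r_def)
  have transfer: "lu_conv (\<lambda>n z. s (z + k (r n))) F" if c: "lu_conv (\<lambda>n z. s (z + h (r n))) F"
    and hk: "\<And>n z. z \<in> cball 0 (real n) \<Longrightarrow> chord (s (z + h n)) (s (z + k n)) < 1 / real (Suc n)" for s F
    unfolding lu_conv_def
  proof (intro allI impI)
    fix K :: "complex set" and e :: real assume K: "compact K" and e: "e > 0"
    obtain N where N: "\<And>n z. n \<ge> N \<Longrightarrow> z \<in> K \<Longrightarrow> chord (s (z + h (r n))) (F z) < e / 2"
      using lu_convE[OF c K, of "e / 2"] e by auto
    obtain B where B: "\<And>z. z \<in> K \<Longrightarrow> cmod z \<le> B"
      using compact_imp_bounded[OF K] unfolding bounded_iff by blast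
    obtain N1 :: nat where N1: "B \<le> real N1" using real_arch_simple by blast
    obtain N2 where N2: "1 / real (Suc N2) < e / 2" using e nat_approx_posE[of "e/2"] by auto
    have "chord (s (z + k (r n))) (F z) < e" if n: "n \<ge> max N (max N1 N2)" and z: "z \<in> K" for n z
    proof -
      have rn: "r n \<ge> n" using r by (rule seq_suble)
      have "z \<in> cball 0 (real (r n))" using B[OF z] N1 n rn by (simp add: dist_norm)
      then have "chord (s (z + h (r n))) (s (z + k (r n))) < 1 / real (Suc (r n))" by (rule hk)
      also have "\<dots> \<le> 1 / real (Suc N2)" using n rn by (intro divide_left_mono) auto
      finally show ?thesis
        using N[of n z] N2 n z chord_triangle[of "s (z + k (r n))" "F z" "s (z + h (r n))"]
          chord_commute[of "s (z + k (r n))" "s (z + h (r n))"] by simp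
    qed
    then show "\<exists>N. \<forall>n\<ge>N. \<forall>z\<in>K. chord (s (z + k (r n))) (F z) < e" by blast
  qed
  have d1: "lu_conv (\<lambda>n z. s1 (z + k (r n))) F1" by (rule transfer[OF c1 hk(1)])
  have d2: "lu_conv (\<lambda>n z. s2 (z + k (r n))) F2" by (rule transfer[OF c2 hk(2)])
  \<comment> \<open>A disc of diameter less than \<open>\<delta>\<close> cannot contain both a zero
    and a pole of \<open>p\<close>.\<close>
  obtain \<rho> where \<rho>: "0 < \<rho>" "\<rho> < \<delta> / 2"
    and good: "\<And>z. z \<in> sphere 0 \<rho> \<Longrightarrow> F1 z \<noteq> None \<and> F1 z \<noteq> Some 0 \<and> F2 z \<noteq> None \<and> F2 z \<noteq> Some 0"
    using smero_good_circle[OF F1(2,3) F2(2,3), of "\<delta> / 2"] \<delta> by auto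
  have cK: "compact (sphere (0::complex) \<rho>)" by simp
  obtain M1 where M1: "M1 \<ge> 1" "\<And>z M'. z \<in> sphere 0 \<rho> \<Longrightarrow> M' \<ge> M1 \<Longrightarrow> \<exists>a. F1 z = Some a \<and> 1 / M' \<le> cmod a \<and> cmod a \<le> M'"
    using smero_compact_bounds[OF F1(2) cK] good by metis
  obtain M2 where M2: "M2 \<ge> 1" "\<And>z M'. z \<in> sphere 0 \<rho> \<Longrightarrow> M' \<ge> M2 \<Longrightarrow> \<exists>a. F2 z = Some a \<and> 1 / M' \<le> cmod a \<and> cmod a \<le> M'"
    using smero_compact_bounds[OF F2(2) cK] good by metis
  define M where "M = max M1 M2"
  have M: "M \<ge> 1" using M1 by (simp add: M_def)
  \<comment> \<open>On the circle the factors have moduli between \<open>1 / (2 * M)\<close> and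
    \<open>2 * M\<close>, so the products have modulus at least \<open>1 / (4 * M\<^sup>2)\<close>
    and differ by at most \<open>8 * M * e\<close>. The first entry puts this difference below that
    lower bound; the second makes the resulting bound \<open>256 * M ^ 5 * e\<close> at most
    \<open>\<epsilon> / 2\<close>.\<close>
  define e where "e = min (1 / (64 * M ^ 3)) (\<epsilon> / (512 * M ^ 5))"
  have e: "e > 0" using M \<epsilon> by (simp add: e_def)
  have e1: "e \<le> 1 / (2 * M)"
  proof -
    have "M \<le> M ^ 3" using M by (simp add: self_le_power)
    then have "2 * M \<le> 64 * M ^ 3" using M by linarith
    then have "1 / (64 * M ^ 3) \<le> 1 / (2 * M)" using M by (intro divide_left_mono) auto
    then show ?thesis by (simp add: e_def)
  qed
  note close = lu_conv_close_bounds[OF _ cK M _ e e1]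
  have G1: "\<forall>z\<in>sphere 0 \<rho>. \<exists>a. F1 z = Some a \<and> 1 / M \<le> cmod a \<and> cmod a \<le> M"
    using M1(2) by (simp add: M_def)
  have G2: "\<forall>z\<in>sphere 0 \<rho>. \<exists>a. F2 z = Some a \<and> 1 / M \<le> cmod a \<and> cmod a \<le> M"
    using M2(2) by (simp add: M_def)
  have "\<forall>\<^sub>F n in sequentially. chord (p (h (r n))) (p (k (r n))) < \<epsilon>"
    using close[OF c1 G1] close[OF d1 G1] close[OF c2 G2] close[OF d2 G2]
  proof eventually_elim
    case (elim n)
    have "chord (p (0 + h (r n))) (p (0 + k (r n))) \<le> 2 * (8 * M * e) / (1 / (4 * M\<^sup>2))\<^sup>2"
    proof (rule disc_close[OF smero_translate[OF p] smero_translate[OF p] \<rho>(1)])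
      fix z :: complex assume z: "z \<in> sphere 0 \<rho>"
      obtain a1 where a1: "s1 (z + h (r n)) = Some a1" "1 / (2 * M) \<le> cmod a1" "cmod a1 \<le> 2 * M" "cmod (a1 - the (F1 z)) \<le> e"
        using bspec[OF elim(1) z] by blast
      obtain b1 where b1: "s1 (z + k (r n)) = Some b1" "1 / (2 * M) \<le> cmod b1" "cmod b1 \<le> 2 * M" "cmod (b1 - the (F1 z)) \<le> e"
        using bspec[OF elim(2) z] by blast
      obtain a2 where a2: "s2 (z + h (r n)) = Some a2" "1 / (2 * M) \<le> cmod a2" "cmod a2 \<le> 2 * M" "cmod (a2 - the (F2 z)) \<le> e"
        using bspec[OF elim(3) z] by blast
      obtain b2 where b2: "s2 (z + k (r n)) = Some b2" "1 / (2 * M) \<le> cmod b2" "cmod b2 \<le> 2 * M" "cmod (b2 - the (F2 z)) \<le> e"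
        using bspec[OF elim(4) z] by blast
      have low: "1 / (4 * M\<^sup>2) = 1 / (2 * M) * (1 / (2 * M))" by (simp add: power2_eq_square)
      have la: "1 / (4 * M\<^sup>2) \<le> cmod (a1 * a2)" unfolding low norm_mult
        using a1 a2 M by (intro mult_mono) auto
      have lb: "1 / (4 * M\<^sup>2) \<le> cmod (b1 * b2)" unfolding low norm_mult
        using b1 b2 M by (intro mult_mono) auto
      have x1: "cmod (a1 - b1) \<le> 2 * e"
        using a1 b1 norm_triangle_ineq4[of "a1 - the (F1 z)" "b1 - the (F1 z)"] by simp
      have x2: "cmod (a2 - b2) \<le> 2 * e"
        using a2 b2 norm_triangle_ineq4[of "a2 - the (F2 z)" "b2 - the (F2 z)"] by simp
      have "a1 * a2 - b1 * b2 = a1 * (a2 - b2) + (a1 - b1) * b2" by (simp add: algebra_simps)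
      then have "cmod (a1 * a2 - b1 * b2) \<le> cmod a1 * cmod (a2 - b2) + cmod (a1 - b1) * cmod b2"
        by (metis norm_mult norm_triangle_ineq)
      also have "\<dots> \<le> 2 * M * (2 * e) + 2 * e * (2 * M)"
        using a1 b2 x1 x2 M e by (intro add_mono mult_mono) auto
      finally have "cmod (a1 * a2 - b1 * b2) \<le> 8 * M * e" by simp
      then show "\<exists>a b. p (z + h (r n)) = Some a \<and> p (z + k (r n)) = Some b \<and> 1 / (4 * M\<^sup>2) \<le> cmod a
          \<and> 1 / (4 * M\<^sup>2) \<le> cmod b \<and> cmod (a - b) \<le> 8 * M * e"
        using la lb mult a1 a2 b1 b2 by blast
    next
      have "1 \<le> M\<^sup>2" using M by simp
      then show "1 / (4 * M\<^sup>2) \<le> 1" "0 < 1 / (4 * M\<^sup>2)" by (auto simp: divide_simps)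
      have "8 * M * e \<le> 8 * M * (1 / (64 * M ^ 3))" using M by (intro mult_left_mono) (auto simp: e_def)
      also have "\<dots> = 1 / (8 * M\<^sup>2)" using M by (simp add: power2_eq_square power3_eq_cube)
      also have "\<dots> < 1 / (4 * M\<^sup>2)" using M by (intro divide_strict_left_mono) auto
      finally show "8 * M * e < 1 / (4 * M\<^sup>2)" .
    qed (use separated_disc[of p \<delta> \<rho>, OF sep] \<rho>(2) in auto)
    also have "\<dots> = 256 * M ^ 5 * e" using M by (simp add: power_divide) (simp add: power2_eq_square eval_nat_numeral)
    also have "\<dots> \<le> 256 * M ^ 5 * (\<epsilon> / (512 * M ^ 5))"
      using M by (intro mult_left_mono) (auto simp: e_def)
    also have "\<dots> = \<epsilon> / 2" using M by simp
    also have "\<dots> < \<epsilon>" using \<epsilon> by simp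
    finally show ?case by simp
  qed
  then show False using far by (simp add: not_le[symmetric])
qed

section \<open>Separation and relative density of zeros and poles\<close>

text \<open>If zeros \<open>a n\<close> and poles \<open>b n\<close> came arbitrarily close, a limit
  of the translates by \<open>a n\<close> would be 0 at the origin, yet nearly infinite at points
  tending to the origin, against its continuity.\<close>

lemma N1s_separated:
  assumes s: "N1s s"
  shows "\<exists>\<delta>>0. \<forall>a b. s a = Some 0 \<longrightarrow> s b = None \<longrightarrow> \<delta> \<le> cmod (a - b)"
proof (rule ccontr)
  assume "\<not> ?thesis"
  then have "\<forall>n. \<exists>a b. s a = Some 0 \<and> s b = None \<and> cmod (a - b) < 1 / real (Suc n)"
    by (metis not_less of_nat_0_less_iff zero_less_Suc zero_less_divide_1_iff)
  then obtain a b where ab: "\<And>n. s (a n) = Some 0" "\<And>n. s (b n) = None" "\<And>n. cmod (a n - b n) < 1 / real (Suc n)"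
    by metis
  obtain r F where r: "strict_mono r" and F: "lu_conv (\<lambda>n z. s (z + a (r n))) F" "smero F"
    using N1s_limit[OF s] by metis
  define w where "w = (\<lambda>n. b (r n) - a (r n))"
  have wn: "cmod (w n) < 1 / real (Suc n)" for n
  proof -
    have "cmod (w n) < 1 / real (Suc (r n))" using ab(3)[of "r n"] by (simp add: w_def norm_minus_commute)
    also have "\<dots> \<le> 1 / real (Suc n)" using seq_suble[OF r, of n] by (intro divide_left_mono) auto
    finally show ?thesis .
  qed
  have "w \<longlonglongrightarrow> 0"
    by (rule Lim_null_comparison[OF always_eventually LIMSEQ_inverse_real_of_nat])
      (use wn in \<open>auto simp: inverse_eq_divide less_imp_le\<close>)
  moreover have "isCont (\<lambda>z. emb (F z)) 0"
    using smero_continuous[OF F(2), of UNIV] by (simp add: continuous_on_eq_continuous_at)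
  ultimately have l: "(\<lambda>n. emb (F (w n))) \<longlonglongrightarrow> emb (F 0)" using isCont_tendsto_compose by blast
  \<comment> \<open>This contradicts the exact value 2: the path from 0 to infinity through
    \<open>F 0\<close> and \<open>F (w n)\<close> has three steps, each shorter than 1/2.\<close>
  have "chord (Some 0) None < 2"
  proof -
    have "1 / 2 > (0::real)" by simp
    then obtain N where N: "\<And>n z. n \<ge> N \<Longrightarrow> z \<in> cball 0 1 \<Longrightarrow> chord (s (z + a (r n))) (F z) < 1 / 2"
      using lu_convE[OF F(1) compact_cball[of 0 1]] by metis
    have "\<forall>\<^sub>F n in sequentially. dist (emb (F (w n))) (emb (F 0)) < 1 / 2"
      by (rule tendstoD[OF l]) simp
    then obtain N' where N': "\<And>n. n \<ge> N' \<Longrightarrow> chord (F (w n)) (F 0) < 1 / 2"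
      unfolding eventually_sequentially chord_dist by blast
    define n where "n = max N N'"
    have "1 / real (Suc n) \<le> 1" by simp
    then have "cmod (w n) \<le> 1" using wn[of n] by linarith
    then have 1: "chord None (F (w n)) < 1 / 2" using N[of n "w n"] ab(2)[of "r n"] by (simp add: n_def w_def)
    have 2: "chord (Some 0) (F 0) < 1 / 2" using N[of n 0] ab(1)[of "r n"] by (simp add: n_def)
    have 3: "chord (F (w n)) (F 0) < 1 / 2" using N'[of n] by (simp add: n_def)
    have "chord (Some 0) None \<le> chord (Some 0) (F 0) + chord (F 0) (F (w n)) + chord (F (w n)) None"
      using chord_triangle[of "Some 0" None "F 0"] chord_triangle[of "F 0" None "F (w n)"] by linarith
    then show ?thesis using 1 2 3 by (simp add: chord_commute)
  qed
  then show False by simp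
qed

text \<open>Every compact set lies in the pole-free discs of all but finitely many \<open>g n\<close>, so Hurwitz applies to the reciprocals.\<close>

lemma hurwitz_pole:
  assumes conv: "lu_conv g F" and g: "\<And>n. smero (g n)" and F0: "F 0 = None"
    and pf: "\<And>n z. cmod z < real n \<Longrightarrow> g n z \<noteq> None"
  shows "F z = None"
proof -
  have F: "smero F" by (rule smero_limit[OF conv g])
  have convi: "lu_conv (\<lambda>n z. oinv (g n z)) (\<lambda>z. oinv (F z))" by (rule lu_conv_oinv[OF conv])
  have gi: "smero (\<lambda>z. oinv (g n z))" for n by (rule smero_oinv[OF g])
  obtain r M where r: "r > 0" and M: "\<And>z. z \<in> cball 0 r \<Longrightarrow> \<exists>b. oinv (F z) = Some b \<and> cmod b \<le> M"
    using continuous_finite_bound[OF lu_conv_continuous[OF convi gi]] F0 by (metis oinv.simps(1) option.distinct(1))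
  have fin: "\<forall>\<^sub>F n in sequentially. \<forall>z\<in>cball 0 r. oinv (g n z) \<noteq> None"
    and lim: "uniform_limit (cball 0 r) (\<lambda>n z. the (oinv (g n z))) (\<lambda>z. the (oinv (F z))) sequentially"
    by (rule lu_conv_finite_uniform_limit[OF convi compact_cball M], assumption)+
  obtain N where N: "\<And>n z. n \<ge> N \<Longrightarrow> z \<in> cball 0 r \<Longrightarrow> oinv (g n z) \<noteq> None"
    using fin unfolding eventually_sequentially by blast
  obtain N' :: nat where N': "r \<le> real N'" using real_arch_simple by blast
  \<comment> \<open>The index shift makes every member of the sequence, not just almost every one,
    holomorphic and zero-free on the disc, as Hurwitz' theorem asks.\<close>
  define G where "G = (\<lambda>n z. the (oinv (g (n + max N N') z)))"
  have Gne: "G n z \<noteq> 0" if "z \<in> ball 0 r" for n z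
  proof
    assume "G n z = 0"
    moreover have "oinv (g (n + max N N') z) \<noteq> None" using N that by auto
    ultimately have "oinv (g (n + max N N') z) = Some 0" unfolding G_def by (metis option.collapse)
    then have "g (n + max N N') z = None" by simp
    moreover have "cmod z < real (n + max N N')" using that N' by simp
    ultimately show False using pf by blast
  qed
  have const: "(\<lambda>z. the (oinv (F z))) constant_on ball 0 r"
  proof (rule ccontr)
    assume nc: "\<not> ?thesis"
    have "the (oinv (F 0)) \<noteq> 0"
    proof (rule Hurwitz_no_zeros[OF open_ball _ _ _ _ nc Gne])
      show "G n holomorphic_on ball 0 r" for n
        unfolding G_def by (rule smero_holomorphic[OF gi]) (use N in auto)
      show "(\<lambda>z. the (oinv (F z))) holomorphic_on ball 0 r"
        by (rule smero_holomorphic[OF smero_oinv[OF F] open_ball]) (metis M ball_subset_cball option.distinct(1) subsetD)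
      show "uniform_limit K G (\<lambda>z. the (oinv (F z))) sequentially" if "K \<subseteq> ball 0 r" for K
      proof -
        have "uniform_limit K (\<lambda>n z. the (oinv (g n z))) (\<lambda>z. the (oinv (F z))) sequentially"
          by (rule uniform_limit_on_subset[OF lim]) (use that ball_subset_cball in blast)
        then show ?thesis unfolding G_def by (rule filterlim_compose) (rule filterlim_add_const_nat_at_top)
      qed
    qed (use r in auto)
    then show False by (simp add: F0)
  qed
  have "F z = None" if "z \<in> ball 0 r" for z
  proof -
    have "the (oinv (F z)) = the (oinv (F 0))"
      using const that r unfolding constant_on_def by (metis centre_in_ball)
    moreover have "\<exists>b. oinv (F z) = Some b" using M[of z] that by auto
    ultimately have "oinv (F z) = Some 0" by (metis F0 oinv.simps(1) option.sel)
    then show ?thesis by simp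
  qed
  then have "ball 0 r \<subseteq> {z. F z = None}" by blast
  moreover have "0 islimpt ball (0::complex) r" using r by (simp add: islimpt_ball)
  ultimately have "0 islimpt {z. F z = None}" using islimpt_subset by blast
  then show ?thesis by (rule smero_poles_isolated[OF F])
qed

lemma N1s_poles_dense:
  assumes s: "N1s s"
  shows "\<exists>R. \<forall>w. \<exists>b. s b = None \<and> b \<in> ball w R"
proof (rule ccontr)
  assume "\<not> ?thesis"
  then have free: "\<exists>w. \<forall>b\<in>ball w R. s b \<noteq> None" for R by (metis (full_types))
  \<comment> \<open>Either large values occur at centres of large pole-free discs and a limit of translates is
    identically infinite, or such values are bounded and a limit is a bounded entire function.\<close>
  show False
  proof (cases "\<forall>j::nat. \<exists>k. (\<forall>b\<in>ball k (real j). s b \<noteq> None) \<and> cmod (the (s k)) > real j")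
    case True
    then obtain k where k: "\<And>j b. b \<in> ball (k j) (real j) \<Longrightarrow> s b \<noteq> None" "\<And>j. cmod (the (s (k j))) > real j"
      by metis
    obtain r F where r: "strict_mono r" and F: "lu_conv (\<lambda>n z. s (z + k (r n))) F" "smero F" "\<And>c. F \<noteq> (\<lambda>_. c)"
      using N1s_limit[OF s] by metis
    have F0: "F 0 = None"
    proof (rule ccontr)
      assume "F 0 \<noteq> None"
      then obtain c where c: "F 0 = Some c" by blast
      then have "uniform_limit {0} (\<lambda>n z. the (s (z + k (r n)))) (\<lambda>z. the (F z)) sequentially"
        by (intro lu_conv_finite_uniform_limit(2)[OF F(1), where M = "cmod c"]) auto
      then have "\<forall>\<^sub>F n in sequentially. dist (the (s (k (r n)))) c < 1"
        using c by (auto simp: uniform_limit_iff dest: spec[of _ 1])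
      moreover have "\<forall>\<^sub>F n in sequentially. real n \<ge> cmod c + 1"
        using filterlim_real_sequentially unfolding filterlim_at_top by blast
      ultimately have "\<forall>\<^sub>F n in sequentially. False"
      proof eventually_elim
        case (elim n)
        have "real n < cmod (the (s (k (r n))))" using k(2)[of "r n"] seq_suble[OF r, of n] by linarith
        then show ?case using elim norm_triangle_ineq2[of "the (s (k (r n)))" c] by (simp add: dist_norm)
      qed
      then show False by simp
    qed
    have "F z = None" for z
    proof (rule hurwitz_pole[OF F(1) _ F0])
      show "smero (\<lambda>z. s (z + k (r n)))" for n using s by (simp add: N1s_def smero_translate)
      fix n :: nat and z :: complex assume "cmod z < real n"
      then have "cmod z < real (r n)" using seq_suble[OF r, of n] by linarith
      then show "s (z + k (r n)) \<noteq> None" by (intro k(1)[of _ "r n"]) (simp add: dist_norm)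
    qed
    then show False using F(3) by blast
  next
    case False
    then obtain j :: nat where j: "\<And>k. (\<And>b. b \<in> ball k (real j) \<Longrightarrow> s b \<noteq> None) \<Longrightarrow> cmod (the (s k)) \<le> real j"
      by (meson not_le)
    \<comment> \<open>The extra \<open>j\<close> in the radius makes each point of
      \<open>ball (w n) (real n)\<close> the centre of a pole-free disc of radius \<open>j\<close>,
      so the bound on values applies on the whole ball.\<close>
    obtain w where w: "\<And>n b. b \<in> ball (w n) (real (n + j)) \<Longrightarrow> s b \<noteq> None"
      using free[of "real (_ + j)"] by metis
    have bd: "\<exists>a. s b = Some a \<and> cmod a \<le> real j" if b: "b \<in> ball (w n) (real n)" for b n
    proof -
      have "cmod (the (s b)) \<le> real j"
      proof (rule j)
        fix b' assume "b' \<in> ball b (real j)"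
        then have "dist (w n) b' < real (n + j)" using b dist_triangle[of "w n" b' b] by simp
        then show "s b' \<noteq> None" by (intro w[of _ n]) simp
      qed
      moreover have "s b \<noteq> None" using b by (intro w[of _ n]) simp
      ultimately show ?thesis by auto
    qed
    obtain r F where r: "strict_mono r" and F: "lu_conv (\<lambda>n z. s (z + w (r n))) F" "smero F" "\<And>c. F \<noteq> (\<lambda>_. c)"
      using N1s_limit[OF s] by metis
    define \<eta> where "\<eta> = 1 / sqrt (1 + (real j)\<^sup>2)"
    have \<eta>: "\<eta> > 0" by (simp add: \<eta>_def add_pos_nonneg)
    have Fb: "\<exists>b. F z = Some b \<and> cmod b \<le> real j + \<eta> * (1 + (real j)\<^sup>2)" for z
    proof -
      obtain N where N: "\<And>n. n \<ge> N \<Longrightarrow> chord (s (z + w (r n))) (F z) < \<eta>"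
        using lu_convE[OF F(1) compact_sing \<eta>] by (metis singletonI)
      obtain N' :: nat where N': "cmod z < real N'" using reals_Archimedean2 by blast
      define n where "n = max N N'"
      have "cmod z < real (r n)" using N' seq_suble[OF r, of n] by (simp add: n_def)
      then obtain a where a: "s (z + w (r n)) = Some a" "cmod a \<le> real j"
        using bd[of "z + w (r n)" "r n"] by (auto simp: dist_norm)
      have "chord (Some a) (F z) \<le> \<eta>" using N[of n] a by (simp add: n_def)
      then obtain b where b: "F z = Some b" "cmod (a - b) \<le> \<eta> * (1 + (real j)\<^sup>2)"
        using chord_close_finite[OF a(2), of "F z" \<eta>] by (auto simp: \<eta>_def)
      then show ?thesis using a(2) norm_triangle_ineq2[of b a] by (simp add: norm_minus_commute)
    qed
    have "(\<lambda>z. the (F z)) holomorphic_on UNIV"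
      by (rule smero_holomorphic[OF F(2)]) (use Fb in fastforce)+
    moreover have "bounded (range (\<lambda>z. the (F z)))"
      unfolding bounded_iff using Fb by (metis (no_types, lifting) imageE option.sel)
    ultimately obtain c where "\<And>z. the (F z) = c"
      using Liouville_theorem unfolding constant_on_def by blast
    then have "F z = Some c" for z using Fb[of z] by (metis option.sel)
    then show False using F(3) by blast
  qed
qed

section \<open>The criterion for normal functions without constant limits\<close>

text \<open>Density of zeros comes from density of poles of the reciprocal. Conversely, a
  subsequence good for both factors is good for the product by \<open>product_close\<close>, and the
  presence of a zero and a pole in every disc of radius \<open>R\<close> excludes constant
  limits.\<close>

lemma N1s_product_iff:
  assumes s1: "N1s s1" and s2: "N1s s2" and p: "smero p"
    and mult: "\<And>z a b. s1 z = Some a \<Longrightarrow> s2 z = Some b \<Longrightarrow> p z = Some (a * b)"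
  shows "N1s p \<longleftrightarrow> (\<exists>\<delta>>0. \<forall>a b. p a = Some 0 \<longrightarrow> p b = None \<longrightarrow> \<delta> \<le> cmod (a - b)) \<and>
    (\<exists>R. \<forall>w. (\<exists>a. p a = Some 0 \<and> a \<in> ball w R) \<and> (\<exists>b. p b = None \<and> b \<in> ball w R))"
    (is "_ \<longleftrightarrow> ?S \<and> ?D")
proof
  assume N: "N1s p"
  obtain R1 where R1: "\<And>w. \<exists>b. p b = None \<and> b \<in> ball w R1"
    using N1s_poles_dense[OF N] by blast
  obtain R2 where R2: "\<And>w. \<exists>a. p a = Some 0 \<and> a \<in> ball w R2"
    using N1s_poles_dense[OF N1s_oinv[OF N]] by auto
  have "\<forall>w. (\<exists>a. p a = Some 0 \<and> a \<in> ball w (max R1 R2)) \<and> (\<exists>b. p b = None \<and> b \<in> ball w (max R1 R2))"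
    using R1 R2 by (simp add: less_max_iff_disj) blast
  with N1s_separated[OF N] show "?S \<and> ?D" by blast
next
  assume "?S \<and> ?D"
  then obtain \<delta> R where \<delta>: "\<delta> > 0" and sep: "\<And>a b. p a = Some 0 \<Longrightarrow> p b = None \<Longrightarrow> \<delta> \<le> cmod (a - b)"
    and R: "\<And>w. \<exists>a. p a = Some 0 \<and> a \<in> ball w R" "\<And>w. \<exists>b. p b = None \<and> b \<in> ball w R"
    by blast
  have "normal_s p"
    unfolding normal_s_def
  proof
    fix h :: "nat \<Rightarrow> complex"
    obtain r1 F1 where r1: "strict_mono r1" and F1: "lu_conv (\<lambda>n z. s1 (z + h (r1 n))) F1"
      using N1s_limit[OF s1] by metis
    obtain r2 F2 where r2: "strict_mono r2" and F2: "lu_conv (\<lambda>n z. s2 (z + h (r1 (r2 n)))) F2"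
      using N1s_limit[OF s2, of "\<lambda>n. h (r1 n)"] by blast
    define r where "r = r1 \<circ> r2"
    have F1: "lu_conv (\<lambda>n z. s1 (z + h (r n))) F1" using lu_conv_subseq[OF F1 r2] by (simp add: r_def)
    have F2: "lu_conv (\<lambda>n z. s2 (z + h (r n))) F2" using F2 by (simp add: r_def)
    have "\<exists>N. \<forall>m\<ge>N. \<forall>n\<ge>N. \<forall>z\<in>K. chord (p (z + h (r m))) (p (z + h (r n))) < \<epsilon>"
      if K: "compact K" and \<epsilon>: "\<epsilon> > 0" for K \<epsilon>
    proof -
      obtain \<eta> R where \<eta>: "\<eta> > 0" and close: "\<And>h k. (\<And>z. z \<in> cball 0 R \<Longrightarrow>
          chord (s1 (z + h)) (s1 (z + k)) < \<eta> \<and> chord (s2 (z + h)) (s2 (z + k)) < \<eta>) \<Longrightarrow> chord (p h) (p k) < \<epsilon>"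
        using product_close[OF s1 s2 p mult \<delta> sep \<epsilon>] by metis
      \<comment> \<open>Closeness of the product at a point of \<open>K\<close> requires closeness
        of the factors on the disc of radius \<open>R\<close> around it; \<open>K'\<close> collects
        all these discs.\<close>
      define K' where "K' = {x + y | x y. x \<in> cball 0 R \<and> y \<in> K}"
      have K': "compact K'" unfolding K'_def by (rule compact_sums[OF compact_cball K])
      obtain N1 where N1: "\<And>n z. n \<ge> N1 \<Longrightarrow> z \<in> K' \<Longrightarrow> chord (s1 (z + h (r n))) (F1 z) < \<eta> / 2"
        using lu_convE[OF F1 K', of "\<eta> / 2"] \<eta> by auto
      obtain N2 where N2: "\<And>n z. n \<ge> N2 \<Longrightarrow> z \<in> K' \<Longrightarrow> chord (s2 (z + h (r n))) (F2 z) < \<eta> / 2"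
        using lu_convE[OF F2 K', of "\<eta> / 2"] \<eta> by auto
      have "chord (p (z + h (r m))) (p (z + h (r n))) < \<epsilon>" if mn: "m \<ge> max N1 N2" "n \<ge> max N1 N2" and z: "z \<in> K" for m n z
      proof (rule close)
        fix y :: complex assume "y \<in> cball 0 R"
        then have yz: "y + z \<in> K'" using z unfolding K'_def by blast
        have "chord (s1 (y + z + h (r m))) (s1 (y + z + h (r n))) < \<eta>"
          using N1[of m, OF _ yz] N1[of n, OF _ yz] mn
            chord_triangle[of "s1 (y + z + h (r m))" "s1 (y + z + h (r n))" "F1 (y + z)"]
            chord_commute[of "s1 (y + z + h (r n))" "F1 (y + z)"] by simp
        moreover have "chord (s2 (y + z + h (r m))) (s2 (y + z + h (r n))) < \<eta>"
          using N2[of m, OF _ yz] N2[of n, OF _ yz] mn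
            chord_triangle[of "s2 (y + z + h (r m))" "s2 (y + z + h (r n))" "F2 (y + z)"]
            chord_commute[of "s2 (y + z + h (r n))" "F2 (y + z)"] by simp
        ultimately show "chord (s1 (y + (z + h (r m)))) (s1 (y + (z + h (r n)))) < \<eta> \<and>
            chord (s2 (y + (z + h (r m)))) (s2 (y + (z + h (r n)))) < \<eta>"
          by (simp add: add.assoc)
      qed
      then show ?thesis by blast
    qed
    moreover have "strict_mono r" unfolding r_def using r1 r2 by (rule strict_mono_o)
    ultimately show "\<exists>r :: nat \<Rightarrow> nat. strict_mono r \<and> (\<forall>K. compact K \<longrightarrow> (\<forall>\<epsilon>>0. \<exists>N. \<forall>m\<ge>N. \<forall>n\<ge>N. \<forall>z\<in>K.
        chord (p (z + h (r m))) (p (z + h (r n))) < \<epsilon>))" by blast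
  qed
  moreover have "\<not> lu_conv (\<lambda>n z. p (z + h n)) (\<lambda>_. c)" for h c
  proof
    assume L: "lu_conv (\<lambda>n z. p (z + h n)) (\<lambda>_. c)"
    \<comment> \<open>The points 0 and infinity have chordal distance 2, so no \<open>c\<close> lies
      within distance less than 1 of both.\<close>
    obtain N where N: "\<And>n z. n \<ge> N \<Longrightarrow> z \<in> cball 0 R \<Longrightarrow> chord (p (z + h n)) c < 1"
      using lu_convE[OF L compact_cball zero_less_one] by metis
    have close: "chord (p a) c < 1" if "a \<in> ball (h N) R" for a
      using N[of N "a - h N"] that by (simp add: dist_norm norm_minus_commute)
    have "chord (Some 0) c < 1"
      using R(1)[of "h N"] close by (elim exE conjE) (metis (no_types))
    moreover have "chord None c < 1"
      using R(2)[of "h N"] close by (elim exE conjE) (metis (no_types))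
    ultimately have "chord (Some 0) c < 1" "chord None c < 1" .
    then show False using chord_triangle[of "Some 0" None c] chord_commute[of c None] by simp
  qed
  ultimately show "N1s p" using p unfolding N1s_def by blast
qed

section \<open>Spherical values of meromorphic functions and almost periodicity\<close>

lemma sval_tendsto:
  assumes "(f \<longlongrightarrow> c) (at z)" shows "sval f z = Some c"
proof -
  have "\<not> filterlim f at_infinity (at z)"
    using assms not_tendsto_and_filterlim_at_infinity[of "at z" f c] by auto
  then show ?thesis using assms by (simp add: sval_def tendsto_Lim)
qed

lemma meromorphic_C_local:
  assumes "meromorphic_C f"
  obtains r where "r > 0" "f holomorphic_on ball z r - {z}"
    "filterlim f at_infinity (at z) \<or> (\<exists>c. (f \<longlongrightarrow> c) (at z))"
proof -
  obtain P where P: "\<And>z. \<not> z islimpt P" "f holomorphic_on (- P)"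
    "\<And>p. p \<in> P \<Longrightarrow> filterlim f at_infinity (at p) \<or> (\<exists>c. (f \<longlongrightarrow> c) (at p))"
    using assms unfolding meromorphic_C_def by blast
  have op: "open (- P)" using P(1) closed_limpt by blast
  obtain e where e: "e > 0" "\<And>x. x \<in> P \<Longrightarrow> x \<noteq> z \<Longrightarrow> \<not> dist x z < e"
    using P(1)[of z] unfolding islimpt_approachable by blast
  then have "ball z e - {z} \<subseteq> - P" by (auto simp: dist_commute)
  then have "f holomorphic_on ball z e - {z}" using P(2) holomorphic_on_subset by blast
  moreover have "filterlim f at_infinity (at z) \<or> (\<exists>c. (f \<longlongrightarrow> c) (at z))"
  proof (cases "z \<in> P")
    case False
    then have "isCont f z"
      using op P(2) holomorphic_on_imp_continuous_on continuous_on_eq_continuous_at by blast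
    then show ?thesis unfolding isCont_def by blast
  qed (rule P(3))
  ultimately show ?thesis using e(1) that by blast
qed

lemma sval_Some_tendsto:
  assumes "meromorphic_C f" "sval f z = Some a" shows "(f \<longlongrightarrow> a) (at z)"
proof -
  have "\<not> filterlim f at_infinity (at z)" using assms(2) by (auto simp: sval_def)
  then obtain c where "(f \<longlongrightarrow> c) (at z)" using meromorphic_C_local[OF assms(1), of z] by metis
  then show ?thesis using sval_tendsto assms(2) by fastforce
qed

lemma sval_mult:
  assumes "meromorphic_C f" "meromorphic_C g" "sval f z = Some a" "sval g z = Some b"
  shows "sval (\<lambda>z. f z * g z) z = Some (a * b)"
  by (rule sval_tendsto[OF tendsto_mult[OF sval_Some_tendsto[OF assms(1,3)] sval_Some_tendsto[OF assms(2,4)]]])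

text \<open>The exceptional sets are united. Products of functions with nonessential singularities
  again have nonessential ones, which includes the points where a zero cancels a pole.\<close>

lemma meromorphic_C_mult:
  assumes f: "meromorphic_C f" and g: "meromorphic_C g"
  shows "meromorphic_C (\<lambda>z. f z * g z)"
proof -
  obtain P where P: "\<And>z. \<not> z islimpt P" "f holomorphic_on (- P)"
    using f unfolding meromorphic_C_def by blast
  obtain Q where Q: "\<And>z. \<not> z islimpt Q" "g holomorphic_on (- Q)"
    using g unfolding meromorphic_C_def by blast
  have sing: "isolated_singularity_at f z \<and> not_essential f z" if f: "meromorphic_C f" for f z
  proof -
    obtain r where "r > 0" "f holomorphic_on ball z r - {z}"
      "filterlim f at_infinity (at z) \<or> (\<exists>c. (f \<longlongrightarrow> c) (at z))"
      by (rule meromorphic_C_local[OF f])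
    then show ?thesis unfolding not_essential_def is_pole_def
      using isolated_singularity_at_holomorphic[of f "ball z r" z] by auto
  qed
  have "(\<lambda>z. f z * g z) holomorphic_on - (P \<union> Q)"
    using P Q by (intro holomorphic_on_mult) (auto elim: holomorphic_on_subset)
  moreover have "\<not> z islimpt (P \<union> Q)" for z using P Q by (simp add: islimpt_Un)
  moreover have "filterlim (\<lambda>z. f z * g z) at_infinity (at p) \<or> (\<exists>c. ((\<lambda>z. f z * g z) \<longlongrightarrow> c) (at p))" for p
    using not_essential_times[of f p g] sing[OF f] sing[OF g] unfolding not_essential_def is_pole_def by blast
  ultimately show ?thesis unfolding meromorphic_C_def by blast
qed

text \<open>At a finite limit the singularity of \<open>f\<close> is removable; at a pole the
  singularity of \<open>1 / f\<close> is, with value 0.\<close>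

lemma smero_sval:
  assumes f: "meromorphic_C f"
  shows "smero (sval f)"
  unfolding smero_def
proof
  fix z0
  obtain r where r: "r > 0" and hol: "f holomorphic_on ball z0 r - {z0}"
    and lim: "filterlim f at_infinity (at z0) \<or> (\<exists>c. (f \<longlongrightarrow> c) (at z0))"
    by (rule meromorphic_C_local[OF f])
  have val: "sval f z = Some (f z)" if "z \<in> ball z0 r - {z0}" for z
  proof -
    have "isCont f z" using that hol holomorphic_on_imp_continuous_on
      continuous_on_eq_continuous_at[of "ball z0 r - {z0}" f] open_delete by blast
    then show ?thesis by (intro sval_tendsto) (simp add: isCont_def)
  qed
  from lim show "\<exists>r>0. \<exists>u. u holomorphic_on ball z0 r \<and>
     ((\<forall>z\<in>ball z0 r. sval f z = Some (u z)) \<or> (\<forall>z\<in>ball z0 r. sval f z = oinv (Some (u z))))"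
  proof
    assume "\<exists>c. (f \<longlongrightarrow> c) (at z0)"
    then obtain c where c: "(f \<longlongrightarrow> c) (at z0)" by blast
    define u where "u = (\<lambda>y. if y = z0 then c else f y)"
    have "u holomorphic_on ball z0 r" unfolding u_def by (rule removable_singularity[OF hol open_ball c])
    moreover have "\<forall>z\<in>ball z0 r. sval f z = Some (u z)"
      using val sval_tendsto[OF c] by (auto simp: u_def)
    ultimately show ?thesis using r by blast
  next
    assume inf: "filterlim f at_infinity (at z0)"
    then have "\<forall>\<^sub>F z in at z0. f z \<noteq> 0" by (rule filterlim_at_infinity_imp_eventually_ne)
    then obtain d where d: "d > 0" "\<And>z. z \<noteq> z0 \<Longrightarrow> dist z z0 < d \<Longrightarrow> f z \<noteq> 0"
      unfolding eventually_at by auto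
    define e where "e = min r d"
    have e: "e > 0" "ball z0 e \<subseteq> ball z0 r" using r d by (auto simp: e_def)
    have nz: "f z \<noteq> 0" if "z \<in> ball z0 e - {z0}" for z using that d(2)[of z] by (auto simp: e_def dist_commute)
    have "f holomorphic_on ball z0 e - {z0}" using hol e(2) by (blast intro: holomorphic_on_subset)
    then have h: "(\<lambda>z. inverse (f z)) holomorphic_on ball z0 e - {z0}"
      using nz by (intro holomorphic_on_inverse) auto
    have l: "((\<lambda>z. inverse (f z)) \<longlongrightarrow> 0) (at z0)"
      using inf filterlim_compose[OF tendsto_inverse_0] by blast
    define u where "u = (\<lambda>y. if y = z0 then 0 else inverse (f y))"
    have "u holomorphic_on ball z0 e" unfolding u_def by (rule removable_singularity[OF h open_ball l])
    moreover have "sval f z0 = None" using inf by (simp add: sval_def)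
    then have "\<forall>z\<in>ball z0 e. sval f z = oinv (Some (u z))"
      using val nz e(2) by (auto simp: u_def inverse_eq_divide)
    ultimately show ?thesis using e(1) by blast
  qed
qed

section \<open>Almost periodic functions are normal without constant limits\<close>

definition AEs :: "(complex \<Rightarrow> complex option) \<Rightarrow> bool" where
  "AEs s \<longleftrightarrow> smero s \<and> (\<exists>z w. s z \<noteq> s w) \<and>
     (\<forall>\<epsilon>>0. \<exists>L. \<forall>w. \<exists>\<tau>. cmod (\<tau> - w) < L \<and> (\<forall>z. chord (s (z + \<tau>)) (s z) < \<epsilon>))"

lemma AEs_almost_period:
  assumes "AEs s" "\<epsilon> > 0"
  obtains L where "L > 0" "\<And>w. \<exists>\<tau>. cmod (\<tau> - w) < L \<and> (\<forall>z. chord (s (z + \<tau>)) (s z) < \<epsilon>)"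
proof -
  obtain L where L: "\<And>w. \<exists>\<tau>. cmod (\<tau> - w) < L \<and> (\<forall>z. chord (s (z + \<tau>)) (s z) < \<epsilon>)"
    using assms unfolding AEs_def by blast
  have "L > 0" using L[of 0] norm_ge_zero le_less_trans by blast
  with L that show ?thesis by blast
qed

text \<open>An almost period near \<open>- z\<close> moves both points into a fixed compact disc at
  the cost of small errors, and on that disc continuity is uniform.\<close>

lemma AEs_uniformly_continuous:
  assumes s: "AEs s" and \<epsilon>: "\<epsilon> > 0"
  obtains d where "d > 0" "\<And>z z'. cmod (z - z') < d \<Longrightarrow> chord (s z) (s z') < \<epsilon>"
proof -
  obtain L where L: "L > 0" "\<And>w. \<exists>\<tau>. cmod (\<tau> - w) < L \<and> (\<forall>z. chord (s (z + \<tau>)) (s z) < \<epsilon> / 3)"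
    using AEs_almost_period[OF s, of "\<epsilon> / 3"] \<epsilon> by auto
  have "uniformly_continuous_on (cball 0 (L + 1)) (\<lambda>z. emb (s z))"
    using s by (intro compact_uniformly_continuous smero_continuous) (auto simp: AEs_def)
  then obtain d where d: "d > 0" "\<And>z z'. z \<in> cball 0 (L + 1) \<Longrightarrow> z' \<in> cball 0 (L + 1) \<Longrightarrow>
      dist z' z < d \<Longrightarrow> dist (emb (s z')) (emb (s z)) < \<epsilon> / 3"
    using \<epsilon> unfolding uniformly_continuous_on_def by (metis divide_pos_pos zero_less_numeral)
  show ?thesis
  \<comment> \<open>The bound 1 keeps the second shifted point inside the disc of radius
    \<open>L + 1\<close>.\<close>
  proof (rule that[of "min d 1"])
    fix z z' assume zz: "cmod (z - z') < min d 1"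
    obtain \<tau> where \<tau>: "cmod (\<tau> - (- z)) < L" "\<And>z. chord (s (z + \<tau>)) (s z) < \<epsilon> / 3" using L(2) by blast
    have 1: "cmod (z + \<tau>) < L" using \<tau>(1) by (simp add: add.commute)
    have "cmod (z' + \<tau>) \<le> cmod (z + \<tau>) + cmod (z - z')"
      using norm_triangle_ineq4[of "z + \<tau>" "z - z'"] by (simp add: add.commute)
    then have "chord (s (z + \<tau>)) (s (z' + \<tau>)) < \<epsilon> / 3"
      unfolding chord_dist using 1 zz by (intro d(2)) (simp_all add: dist_norm[of z z'])
    then show "chord (s z) (s z') < \<epsilon>"
      using \<tau>(2)[of z] \<tau>(2)[of z'] chord_triangle[of "s z" "s z'" "s (z + \<tau>)"]
        chord_triangle[of "s (z + \<tau>)" "s z'" "s (z' + \<tau>)"] chord_commute[of "s z" "s (z + \<tau>)"] by linarith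
  qed (use d in auto)
qed

text \<open>The translates form a bounded equicontinuous family of maps into the sphere, so
  Arzela-Ascoli gives convergence on each disc \<open>cball 0 i\<close>, and a diagonal sequence
  serves all discs.\<close>

lemma uniformly_continuous_normal_s:
  assumes uc: "\<And>\<epsilon>. \<epsilon> > 0 \<Longrightarrow> \<exists>d>0. \<forall>z z'. cmod (z - z') < d \<longrightarrow> chord (s z) (s z') < \<epsilon>"
  shows "normal_s s"
  unfolding normal_s_def
proof
  fix h :: "nat \<Rightarrow> complex"
  define P where "P = (\<lambda>i (h :: nat \<Rightarrow> complex). \<forall>\<epsilon>>0. \<exists>N. \<forall>m\<ge>N. \<forall>n\<ge>N. \<forall>z\<in>cball 0 (real i).
      chord (s (z + h m)) (s (z + h n)) < \<epsilon>)"
  have sub: "\<exists>k. strict_mono (k :: nat \<Rightarrow> nat) \<and> P i (h \<circ> k)" for i h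
  proof -
    obtain g k where "strict_mono (k :: nat \<Rightarrow> nat)"
      and lim: "\<And>e. 0 < e \<Longrightarrow> \<exists>N. \<forall>n x. n \<ge> N \<and> x \<in> cball 0 (real i) \<longrightarrow> norm (emb (s (x + h (k n))) - g x) < e"
    proof (rule Arzela_Ascoli[of "cball 0 (real i)" "\<lambda>n x. emb (s (x + h n))" 1])
      fix x :: complex and e :: real assume "0 < e"
      then obtain d where d: "d > 0" "\<And>z z'. cmod (z - z') < d \<Longrightarrow> chord (s z) (s z') < e"
        using uc by blast
      then show "\<exists>d>0. \<forall>n y. y \<in> cball 0 (real i) \<and> cmod (x - y) < d \<longrightarrow> norm (emb (s (x + h n)) - emb (s (y + h n))) < e"
        by (intro exI[of _ d]) (auto simp flip: chord_dist dist_norm simp: add_diff_add)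
    qed (auto simp: norm_emb)
    have "P i (h \<circ> k)"
      unfolding P_def
    proof (intro allI impI)
      fix \<epsilon> :: real assume "\<epsilon> > 0"
      then obtain N where N: "\<And>n x. n \<ge> N \<Longrightarrow> x \<in> cball 0 (real i) \<Longrightarrow> dist (emb (s (x + h (k n)))) (g x) < \<epsilon> / 2"
        using lim[of "\<epsilon> / 2"] unfolding dist_norm by auto
      have "chord (s (z + (h \<circ> k) m)) (s (z + (h \<circ> k) n)) < \<epsilon>" if "m \<ge> N" "n \<ge> N" "z \<in> cball 0 (real i)" for m n z
        unfolding chord_dist comp_def
        using N[OF that(1,3)] N[OF that(2,3)] dist_triangle_half_l by blast
      then show "\<exists>N. \<forall>m\<ge>N. \<forall>n\<ge>N. \<forall>z\<in>cball 0 (real i). chord (s (z + (h \<circ> k) m)) (s (z + (h \<circ> k) n)) < \<epsilon>"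
        by blast
    qed
    with \<open>strict_mono k\<close> show ?thesis by blast
  qed
  \<comment> \<open>The diagonal sequence is a subsequence of the \<open>i\<close>-th one only from
    some index on, so \<open>P i\<close> must survive changing finitely many terms.\<close>
  have P_P: "P i (h \<circ> k2)" if P: "P i (h \<circ> k1)" and k: "\<And>j. N \<le> j \<Longrightarrow> \<exists>j'\<ge>j. k2 j = k1 j'" for i h and k1 k2 :: "nat \<Rightarrow> nat" and N
    unfolding P_def
  proof (intro allI impI)
    fix \<epsilon> :: real assume "\<epsilon> > 0"
    then obtain M where M: "\<And>m n z. m \<ge> M \<Longrightarrow> n \<ge> M \<Longrightarrow> z \<in> cball 0 (real i) \<Longrightarrow>
        chord (s (z + h (k1 m))) (s (z + h (k1 n))) < \<epsilon>"
      using P unfolding P_def comp_def by meson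
    have "chord (s (z + h (k2 m))) (s (z + h (k2 n))) < \<epsilon>" if "m \<ge> max M N" "n \<ge> max M N" "z \<in> cball 0 (real i)" for m n z
    proof -
      have "N \<le> m" "N \<le> n" using that by auto
      then obtain m' n' where "m' \<ge> m" "k2 m = k1 m'" "n' \<ge> n" "k2 n = k1 n'" using k by meson
      then show ?thesis using M[of m' n' z] that by simp
    qed
    then show "\<exists>N. \<forall>m\<ge>N. \<forall>n\<ge>N. \<forall>z\<in>cball 0 (real i). chord (s (z + (h \<circ> k2) m)) (s (z + (h \<circ> k2) n)) < \<epsilon>"
      unfolding comp_def by blast
  qed
  obtain k :: "nat \<Rightarrow> nat" where k: "strict_mono k" "\<And>i. P i (h \<circ> k)"
    by (rule subsequence_diagonalization_lemma[of P h, OF sub P_P]) (assumption | blast)+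
  have "\<exists>N. \<forall>m\<ge>N. \<forall>n\<ge>N. \<forall>z\<in>K. chord (s (z + h (k m))) (s (z + h (k n))) < \<epsilon>" if K: "compact K" and "\<epsilon> > 0" for K \<epsilon>
  proof -
    obtain B where B: "\<And>z. z \<in> K \<Longrightarrow> cmod z \<le> B"
      using compact_imp_bounded[OF K] unfolding bounded_iff by blast
    obtain i :: nat where "B \<le> real i" using real_arch_simple by blast
    then have "z \<in> cball 0 (real i)" if "z \<in> K" for z using B[OF that] by simp
    moreover obtain N where "\<And>m n z. m \<ge> N \<Longrightarrow> n \<ge> N \<Longrightarrow> z \<in> cball 0 (real i) \<Longrightarrow> chord (s (z + h (k m))) (s (z + h (k n))) < \<epsilon>"
      using k(2)[of i] \<open>\<epsilon> > 0\<close> unfolding P_def comp_def by meson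
    ultimately show ?thesis by blast
  qed
  with k(1) show "\<exists>r :: nat \<Rightarrow> nat. strict_mono r \<and> (\<forall>K. compact K \<longrightarrow> (\<forall>\<epsilon>>0. \<exists>N. \<forall>m\<ge>N. \<forall>n\<ge>N. \<forall>z\<in>K.
        chord (s (z + h (r m))) (s (z + h (r n))) < \<epsilon>))" by blast
qed

text \<open>If translates tend to a constant \<open>c\<close>, an almost period near a far shift
  \<open>h N\<close> carries closeness to \<open>c\<close> back to any given point, so the function
  itself would be constant.\<close>

lemma AEs_imp_N1s:
  assumes s: "AEs s"
  shows "N1s s"
proof -
  have "normal_s s"
    by (rule uniformly_continuous_normal_s) (meson AEs_uniformly_continuous[OF s])
  moreover have "\<not> lu_conv (\<lambda>n z. s (z + h n)) (\<lambda>_. c)" for h c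
  proof
    assume L: "lu_conv (\<lambda>n z. s (z + h n)) (\<lambda>_. c)"
    have "chord (s z) c \<le> \<epsilon>" if \<epsilon>: "\<epsilon> > 0" for z \<epsilon>
    proof -
      obtain L' where L': "\<And>w. \<exists>\<tau>. cmod (\<tau> - w) < L' \<and> (\<forall>z. chord (s (z + \<tau>)) (s z) < \<epsilon> / 2)"
        using AEs_almost_period[OF s half_gt_zero[OF \<epsilon>]] by blast
      obtain N where N: "\<And>n w. n \<ge> N \<Longrightarrow> w \<in> cball 0 (cmod z + L') \<Longrightarrow> chord (s (w + h n)) c < \<epsilon> / 2"
        using lu_convE[OF L compact_cball, of "\<epsilon> / 2"] \<epsilon> by (metis half_gt_zero)
      obtain \<tau> where \<tau>: "cmod (\<tau> - h N) < L'" "chord (s (z + \<tau>)) (s z) < \<epsilon> / 2" using L' by blast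
      have "cmod (z + \<tau> - h N) \<le> cmod z + L'"
        using norm_triangle_ineq[of z "\<tau> - h N"] \<tau>(1) by (simp add: add_diff_eq)
      then have "chord (s (z + \<tau>)) c < \<epsilon> / 2" using N[of N "z + \<tau> - h N"] by simp
      then show ?thesis
        using \<tau>(2) chord_triangle[of "s z" c "s (z + \<tau>)"] chord_commute[of "s z" "s (z + \<tau>)"] by linarith
    qed
    then have "chord (s z) c \<le> 0" for z by (rule field_le_epsilon) simp
    then have "s z = c" for z using chord_nonneg[of "s z" c] chord_eq_0_iff by (metis order_antisym)
    then show False using s unfolding AEs_def by metis
  qed
  ultimately show ?thesis using s unfolding N1s_def AEs_def by blast
qed

section \<open>Common almost periods of two functions\<close>

text \<open>The net is taken from the range itself, so its centres are again values of
  \<open>\<phi>\<close> and can be subtracted as shifts.\<close>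

lemma finite_net_range:
  fixes \<phi> :: "'a \<Rightarrow> 'b::heine_borel"
  assumes b: "bounded (range \<phi>)" and d: "d > 0"
  obtains H where "finite H" "\<And>h. \<exists>j\<in>H. dist (\<phi> h) (\<phi> j) < d"
proof -
  have "closure (range \<phi>) \<subseteq> (\<Union>j\<in>UNIV. ball (\<phi> j) d)"
  proof
    fix x assume "x \<in> closure (range \<phi>)"
    then obtain y where "y \<in> range \<phi>" "dist y x < d" using d unfolding closure_approachable by blast
    then show "x \<in> (\<Union>j\<in>UNIV. ball (\<phi> j) d)" by auto
  qed
  moreover have "compact (closure (range \<phi>))" using b by (simp add: compact_closure)
  ultimately obtain H where "finite H" and H: "closure (range \<phi>) \<subseteq> (\<Union>j\<in>H. ball (\<phi> j) d)"
    using compactE_image[of "closure (range \<phi>)" UNIV "\<lambda>j. ball (\<phi> j) d"] by (metis open_ball)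
  have "\<exists>j\<in>H. dist (\<phi> h) (\<phi> j) < d" for h
  proof -
    have "\<phi> h \<in> (\<Union>j\<in>H. ball (\<phi> j) d)"
      by (rule subsetD[OF H subsetD[OF closure_subset rangeI]])
    then show ?thesis by (auto simp: dist_commute)
  qed
  with \<open>finite H\<close> that show ?thesis by blast
qed

text \<open>Bohr's argument: up to small errors all translates of the pair come from shifts in a bounded set, so
  finitely many of them form a net; differences of shifts in the same cell are common almost periods.\<close>

lemma common_almost_periods:
  assumes s1: "AEs s1" and s2: "AEs s2" and \<epsilon>: "\<epsilon> > 0"
  shows "\<exists>L. \<forall>w. \<exists>\<tau>. cmod (\<tau> - w) < L \<and>
    (\<forall>z. chord (s1 (z + \<tau>)) (s1 z) < \<epsilon> \<and> chord (s2 (z + \<tau>)) (s2 z) < \<epsilon>)"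
proof -
  have e3: "\<epsilon> / 3 > 0" using \<epsilon> by simp
  obtain L1 where L1: "\<And>w. \<exists>\<tau>. cmod (\<tau> - w) < L1 \<and> (\<forall>z. chord (s1 (z + \<tau>)) (s1 z) < \<epsilon> / 3)"
    using AEs_almost_period[OF s1 e3] by blast
  obtain L2 where L2: "\<And>w. \<exists>\<tau>. cmod (\<tau> - w) < L2 \<and> (\<forall>z. chord (s2 (z + \<tau>)) (s2 z) < \<epsilon> / 3)"
    using AEs_almost_period[OF s2 e3] by blast
  \<comment> \<open>An almost period near \<open>- h\<close> keeps \<open>h + t1 h\<close> bounded
    while translation by it nearly agrees with translation by \<open>h\<close>.\<close>
  obtain t1 where t1: "\<And>h. cmod (t1 h - (- h)) < L1" "\<And>h z. chord (s1 (z + t1 h)) (s1 z) < \<epsilon> / 3"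
    using L1[of "- _"] by metis
  obtain t2 where t2: "\<And>h. cmod (t2 h - (- h)) < L2" "\<And>h z. chord (s2 (z + t2 h)) (s2 z) < \<epsilon> / 3"
    using L2[of "- _"] by metis
  obtain d1 where d1: "d1 > 0" "\<And>z z'. cmod (z - z') < d1 \<Longrightarrow> chord (s1 z) (s1 z') < \<epsilon> / 3"
    using AEs_uniformly_continuous[OF s1 e3] by blast
  obtain d2 where d2: "d2 > 0" "\<And>z z'. cmod (z - z') < d2 \<Longrightarrow> chord (s2 z) (s2 z') < \<epsilon> / 3"
    using AEs_uniformly_continuous[OF s2 e3] by blast
  define \<phi> where "\<phi> = (\<lambda>h. (h + t1 h, h + t2 h))"
  have "range \<phi> \<subseteq> cball 0 L1 \<times> cball 0 L2"
    using t1(1) t2(1) by (auto simp: \<phi>_def add.commute less_imp_le)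
  then have "bounded (range \<phi>)"
    by (rule bounded_subset[rotated]) (intro bounded_Times bounded_cball)
  then obtain H where H: "finite H" "\<And>h. \<exists>j\<in>H. dist (\<phi> h) (\<phi> j) < min d1 d2"
    using finite_net_range[of \<phi> "min d1 d2"] d1(1) d2(1) by auto
  obtain B where B: "\<And>j. j \<in> H \<Longrightarrow> cmod j \<le> B"
    using finite_imp_bounded[OF H(1)] unfolding bounded_iff by blast
  have "\<exists>\<tau>. cmod (\<tau> - w) < B + 1 \<and>
    (\<forall>z. chord (s1 (z + \<tau>)) (s1 z) < \<epsilon> \<and> chord (s2 (z + \<tau>)) (s2 z) < \<epsilon>)" for w
  proof -
    obtain j where j: "j \<in> H" "dist (\<phi> w) (\<phi> j) < min d1 d2" using H(2) by blast
    have c1: "cmod ((w + t1 w) - (j + t1 j)) < d1"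
      using j(2) dist_fst_le[of "\<phi> w" "\<phi> j"] by (simp add: \<phi>_def dist_norm)
    have c2: "cmod ((w + t2 w) - (j + t2 j)) < d2"
      using j(2) dist_snd_le[of "\<phi> w" "\<phi> j"] by (simp add: \<phi>_def dist_norm)
    \<comment> \<open>Three small steps: add the almost period \<open>t w\<close>, move to the
      nearby point \<open>z + t j\<close>, and remove the almost period \<open>t j\<close>.\<close>
    have per: "chord (s (z + (w - j))) (s z) < \<epsilon>"
      if t: "\<And>h z. chord (s (z + t h)) (s z) < \<epsilon> / 3" and c: "cmod ((w + t w) - (j + t j)) < d"
        and d: "\<And>z z'. cmod (z - z') < d \<Longrightarrow> chord (s z) (s z') < \<epsilon> / 3" for s t d z
    proof -
      have "chord (s (z + (w - j))) (s (z + (w - j) + t w)) < \<epsilon> / 3" using t chord_commute by metis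
      moreover have "chord (s (z + (w - j) + t w)) (s (z + t j)) < \<epsilon> / 3"
        using c by (intro d) (simp add: algebra_simps)
      moreover have "chord (s (z + t j)) (s z) < \<epsilon> / 3" by (rule t)
      ultimately show ?thesis
        using chord_triangle[of "s (z + (w - j))" "s z" "s (z + (w - j) + t w)"]
          chord_triangle[of "s (z + (w - j) + t w)" "s z" "s (z + t j)"] by linarith
    qed
    have "cmod (w - j - w) < B + 1" using B[OF j(1)] by simp
    then show ?thesis using per[of s1 t1, OF t1(2) c1 d1(2)] per[of s2 t2, OF t2(2) c2 d2(2)] by blast
  qed
  then show ?thesis by blast
qed

section \<open>The criterion for almost periodic functions\<close>

text \<open>Necessity is inherited from the normal case. For sufficiency,
  \<open>product_close\<close> turns common \<open>\<eta>\<close>-almost periods of the factors into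
  \<open>\<epsilon>\<close>-almost periods of \<open>p\<close>, which is nonconstant because it has
  both a zero and a pole.\<close>

lemma AEs_product_iff:
  assumes s1: "AEs s1" and s2: "AEs s2" and p: "smero p"
    and mult: "\<And>z a b. s1 z = Some a \<Longrightarrow> s2 z = Some b \<Longrightarrow> p z = Some (a * b)"
  shows "AEs p \<longleftrightarrow> (\<exists>\<delta>>0. \<forall>a b. p a = Some 0 \<longrightarrow> p b = None \<longrightarrow> \<delta> \<le> cmod (a - b)) \<and>
    (\<exists>R. \<forall>w. (\<exists>a. p a = Some 0 \<and> a \<in> ball w R) \<and> (\<exists>b. p b = None \<and> b \<in> ball w R))"
    (is "_ \<longleftrightarrow> ?S \<and> ?D")
proof
  assume "AEs p"
  then show "?S \<and> ?D"
    using N1s_product_iff[OF AEs_imp_N1s[OF s1] AEs_imp_N1s[OF s2] p mult] AEs_imp_N1s by blast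
next
  assume SD: "?S \<and> ?D"
  then obtain \<delta> where \<delta>: "\<delta> > 0" and sep: "\<And>a b. p a = Some 0 \<Longrightarrow> p b = None \<Longrightarrow> \<delta> \<le> cmod (a - b)"
    by blast
  have "\<exists>L. \<forall>w. \<exists>\<tau>. cmod (\<tau> - w) < L \<and> (\<forall>z. chord (p (z + \<tau>)) (p z) < \<epsilon>)" if \<epsilon>: "\<epsilon> > 0" for \<epsilon>
  proof -
    obtain \<eta> R where \<eta>: "\<eta> > 0" and close: "\<And>h k. (\<And>z. z \<in> cball 0 R \<Longrightarrow>
        chord (s1 (z + h)) (s1 (z + k)) < \<eta> \<and> chord (s2 (z + h)) (s2 (z + k)) < \<eta>) \<Longrightarrow> chord (p h) (p k) < \<epsilon>"
      using product_close[OF AEs_imp_N1s[OF s1] AEs_imp_N1s[OF s2] p mult \<delta> sep \<epsilon>] by metis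
    obtain L where L: "\<And>w. \<exists>\<tau>. cmod (\<tau> - w) < L \<and>
        (\<forall>z. chord (s1 (z + \<tau>)) (s1 z) < \<eta> \<and> chord (s2 (z + \<tau>)) (s2 z) < \<eta>)"
      using common_almost_periods[OF s1 s2 \<eta>] by blast
    have "chord (p (z + \<tau>)) (p z) < \<epsilon>"
      if "\<forall>z. chord (s1 (z + \<tau>)) (s1 z) < \<eta> \<and> chord (s2 (z + \<tau>)) (s2 z) < \<eta>" for \<tau> z
      by (rule close) (use that in \<open>simp flip: add.assoc\<close>)
    then show ?thesis using L by meson
  qed
  moreover have "\<exists>z w. p z \<noteq> p w"
  proof -
    obtain a b where "p a = Some 0" "p b = None" using SD by blast
    then have "p a \<noteq> p b" by simp
    then show ?thesis by blast
  qed
  ultimately show "AEs p" using p unfolding AEs_def by blast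
qed

lemma class_N1_iff: "class_N1 f \<longleftrightarrow> meromorphic_C f \<and> N1s (sval f)"
  unfolding class_N1_def N1s_def normal_mero_def normal_s_def translate_limit_def lu_conv_def
  by (cases "meromorphic_C f") (simp_all only: smero_sval simp_thms)

lemma class_AE_iff: "class_AE f \<longleftrightarrow> meromorphic_C f \<and> AEs (sval f)"
  unfolding class_AE_def AEs_def using smero_sval by blast

theorem mainTheorem15:
  fixes f1 f2 :: "complex \<Rightarrow> complex"
  shows "(class_N1 f1 \<longrightarrow> class_N1 f2 \<longrightarrow>
           (class_N1 (\<lambda>z. f1 z * f2 z) \<longleftrightarrow>
             (\<exists>\<delta>>0. \<forall>a\<in>mzeros (\<lambda>z. f1 z * f2 z). \<forall>b\<in>mpoles (\<lambda>z. f1 z * f2 z). \<delta> \<le> cmod (a - b)) \<and>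
             (\<exists>R0. \<forall>w. (\<exists>a\<in>mzeros (\<lambda>z. f1 z * f2 z). a \<in> ball w R0) \<and>
                        (\<exists>b\<in>mpoles (\<lambda>z. f1 z * f2 z). b \<in> ball w R0))))
       \<and> (class_AE f1 \<longrightarrow> class_AE f2 \<longrightarrow>
           (class_AE (\<lambda>z. f1 z * f2 z) \<longleftrightarrow>
             (\<exists>\<delta>>0. \<forall>a\<in>mzeros (\<lambda>z. f1 z * f2 z). \<forall>b\<in>mpoles (\<lambda>z. f1 z * f2 z). \<delta> \<le> cmod (a - b)) \<and>
             (\<exists>R0. \<forall>w. (\<exists>a\<in>mzeros (\<lambda>z. f1 z * f2 z). a \<in> ball w R0) \<and>
                        (\<exists>b\<in>mpoles (\<lambda>z. f1 z * f2 z). b \<in> ball w R0))))"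
    (is "(_ \<longrightarrow> _ \<longrightarrow> (_ \<longleftrightarrow> ?D)) \<and> _")
proof -
  define p where "p = sval (\<lambda>z. f1 z * f2 z)"
  have D: "?D \<longleftrightarrow> (\<exists>\<delta>>0. \<forall>a b. p a = Some 0 \<longrightarrow> p b = None \<longrightarrow> \<delta> \<le> cmod (a - b)) \<and>
    (\<exists>R. \<forall>w. (\<exists>a. p a = Some 0 \<and> a \<in> ball w R) \<and> (\<exists>b. p b = None \<and> b \<in> ball w R))"
    by (simp add: mzeros_def mpoles_def p_def)
  have "class_N1 (\<lambda>z. f1 z * f2 z) \<longleftrightarrow> ?D" if "class_N1 f1" "class_N1 f2"
    using that N1s_product_iff[of "sval f1" "sval f2" p] smero_sval meromorphic_C_mult[of f1 f2] sval_mult[of f1 f2]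
    unfolding D class_N1_iff p_def by blast
  moreover have "class_AE (\<lambda>z. f1 z * f2 z) \<longleftrightarrow> ?D" if "class_AE f1" "class_AE f2"
    using that AEs_product_iff[of "sval f1" "sval f2" p] smero_sval meromorphic_C_mult[of f1 f2] sval_mult[of f1 f2]
    unfolding D class_AE_iff p_def by blast
  ultimately show ?thesis by blast
qed

end
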